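(* Let $\mathrm{G}$ be any weighted directed graph on the $C \ge 2$ packet colors whose weights satisfy the triangle inequality, let $L \ge 1$ be the minimal laxity, and let $\gamma = \mathrm{TSP}(\mathrm{G})/L$. If $\gamma < 1/\log C$, then no deterministic online algorithm can achieve a competitive ratio better than $1 - \Omega\big(\sqrt{\gamma/\log C}\big)$ for the colored packet scheduling problem with transition costs given by $\mathrm{G}$. If $\gamma \ge 1/\log C$, then no deterministic online algorithm can achieve a competitive ratio better than $1 - \Omega(1/\log C)$.
   Context: Colored packet scheduling with transition costs: there are $C$ colors, and transition costs $w(j,k) \ge 0$ for ordered pairs of colors $j \ne k$ (not necessarily symmetric), with $w(j,j)=0$ and $w(j,k) \le w(j,l) + w(l,k)$ for all $j,k,l$; this is the weighted directed graph $\mathrm{G}$. $\mathrm{TSP}(\mathrm{G})$ is the minimum weight of a directed closed tour visiting every color. Packets arrive online; packet $i$ is a triple $(r_i, d_i, c_i)$ with release time $r_i \in \mathbb{N}_+$, deadline $d_i \in \mathbb{N}_+$ and color $c_i$. Time is slotted. In each time slot the switch either transmits one pending packet, is in a color-transition phase, or is idle. A scheduled packet $i$ must be transmitted in a slot in $[r_i, d_i]$, otherwise it is dropped. Between the transmission of a packet of color $j$ and the next transmitted packet of color $k \ne j$ there must be $w(j,k)$ transition slots. The goal is to maximize the number of transmitted packets. $\mathrm{ALG}(\sigma)$ and $\mathrm{OPT}(\sigma)$ denote the number of packets transmitted by the online algorithm and by an optimal offline schedule on input $\sigma$. The minimal laxity is $L = \min_i (d_i - r_i) \ge 1$. An online algorithm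 has competitive ratio $\rho \le 1$ if $\mathrm{ALG}(\sigma) \ge \rho \cdot \mathrm{OPT}(\sigma)$ for every input $\sigma$. "No online algorithm can achieve a competitive ratio better than $1 - \Omega(f)$" means there is an absolute constant $c > 0$ such that for every deterministic online algorithm there is an input $\sigma$ with minimal laxity $L$ satisfying $\mathrm{ALG}(\sigma) \le (1 - c f)\,\mathrm{OPT}(\sigma)$. *)

theory Defs
  imports Complex_Main
begin

text \<open>
  Colors are the numbers below \<open>C\<close>, so that one constant can be chosen uniformly in \<open>C\<close>.
\<close>

definition transition_costs :: "nat \<Rightarrow> (nat \<Rightarrow> nat \<Rightarrow> real) \<Rightarrow> bool" where
  "transition_costs C w \<longleftrightarrow>
     (\<forall>j<C. w j j = 0) \<and>
     (\<forall>j<C. \<forall>k<C. 0 \<le> w j k) \<and>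
     (\<forall>j<C. \<forall>k<C. \<forall>l<C. w j k \<le> w j l + w l k)"

text \<open>
  The list \<open>xs\<close> stands for the closed walk that visits its entries in order and then
  returns from the last entry to the first.
\<close>

definition tour_weight :: "(nat \<Rightarrow> nat \<Rightarrow> real) \<Rightarrow> nat list \<Rightarrow> real" where
  "tour_weight w xs = (\<Sum>i<length xs. w (xs ! i) (xs ! (Suc i mod length xs)))"

text \<open>
  Tours may revisit colors. The infimum is a minimum: by the triangle inequality, skipping
  repeated visits does not increase the weight, and only finitely many tours have no repetition.
\<close>

definition TSP :: "nat \<Rightarrow> (nat \<Rightarrow> nat \<Rightarrow> real) \<Rightarrow> real" where
  "TSP C w = Inf {tour_weight w xs | xs. set xs = {..<C}}"

datatype packet = Packet (release: nat) (deadline: nat) (color: nat)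

text \<open>
  An input lists the packets in order of arrival; packet \<open>i\<close> is its \<open>i\<close>-th entry, so
  packets with identical data remain distinguishable. Slots are numbered from 1, and the
  standing assumption that the minimal laxity is at least 1 is \<open>release p < deadline p\<close>.
\<close>

definition valid_input :: "nat \<Rightarrow> packet list \<Rightarrow> bool" where
  "valid_input C \<sigma> \<longleftrightarrow>
     sorted (map release \<sigma>) \<and>
     (\<forall>p\<in>set \<sigma>. 1 \<le> release p \<and> release p < deadline p \<and> color p < C)"

definition min_laxity :: "packet list \<Rightarrow> nat" where
  "min_laxity \<sigma> = Min ((\<lambda>p. deadline p - release p) ` set \<sigma>)"

text \<open>\<open>Transmit i\<close> names a packet by its position in the input.\<close>

datatype action = Transmit nat | Transition | Idle

type_synonym schedule = "nat \<Rightarrow> action"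

text \<open>
  The last condition concerns consecutive transmissions. Costs are real numbers; since the
  number of slots is an integer, a cost \<open>x\<close> requires at least \<open>\<lceil>x\<rceil>\<close> transition slots.
\<close>

definition feasible :: "(nat \<Rightarrow> nat \<Rightarrow> real) \<Rightarrow> packet list \<Rightarrow> schedule \<Rightarrow> bool" where
  "feasible w \<sigma> S \<longleftrightarrow>
     (\<forall>t i. S t = Transmit i \<longrightarrow>
        i < length \<sigma> \<and> release (\<sigma> ! i) \<le> t \<and> t \<le> deadline (\<sigma> ! i)) \<and>
     (\<forall>s t i. S s = Transmit i \<longrightarrow> S t = Transmit i \<longrightarrow> s = t) \<and>
     (\<forall>s t i j. s < t \<longrightarrow> S s = Transmit i \<longrightarrow> S t = Transmit j \<longrightarrow>
        (\<forall>u k. s < u \<longrightarrow> u < t \<longrightarrow> S u \<noteq> Transmit k) \<longrightarrow>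
        color (\<sigma> ! i) \<noteq> color (\<sigma> ! j) \<longrightarrow>
        w (color (\<sigma> ! i)) (color (\<sigma> ! j)) \<le> real (card {u. s < u \<and> u < t \<and> S u = Transition}))"

definition throughput :: "schedule \<Rightarrow> nat" where
  "throughput S = card {i. \<exists>t. S t = Transmit i}"

definition OPT :: "(nat \<Rightarrow> nat \<Rightarrow> real) \<Rightarrow> packet list \<Rightarrow> nat" where
  "OPT w \<sigma> = Max {throughput S | S. feasible w \<sigma> S}"

text \<open>
  A deterministic online algorithm chooses the action for slot \<open>t\<close> from \<open>t\<close> and the packets
  released up to and including \<open>t\<close>; its own earlier actions are determined by these data.
  As valid inputs are sorted by release time, the packets released so far form a prefix of
  the input, hence positions in that prefix are positions in the whole input.
\<close>

type_synonym algorithm = "nat \<Rightarrow> packet list \<Rightarrow> action"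

definition run :: "algorithm \<Rightarrow> packet list \<Rightarrow> schedule" where
  "run A \<sigma> = (\<lambda>t. A t (filter (\<lambda>p. release p \<le> t) \<sigma>))"

definition online_algorithm :: "nat \<Rightarrow> (nat \<Rightarrow> nat \<Rightarrow> real) \<Rightarrow> algorithm \<Rightarrow> bool" where
  "online_algorithm C w A \<longleftrightarrow> (\<forall>\<sigma>. valid_input C \<sigma> \<longrightarrow> feasible w \<sigma> (run A \<sigma>))"

definition ALG :: "algorithm \<Rightarrow> packet list \<Rightarrow> nat" where
  "ALG A \<sigma> = throughput (run A \<sigma>)"

end

theory Submission
  imports Defs "HOL-Combinatorics.Cycles" "HOL-Library.Sublist"
begin

text \<open>
  The offline part extracts a hard set of colors from the transition costs. By duality for minimum
  cycle covers, contracting every cycle to a representative at least halves the number of colors,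
  so some set of colors carries integral prices of total at least \<open>TSP / log C\<close> such that every tour
  pays for the colors it visits. Restricting to an extremal subset, the total price \<open>x\<close> is moreover
  within a factor 2 of the cost of a tour through all of its colors and a root color.

  The online part is a single threat. After a bulk of root packets come periods, each asking for
  \<open>K\<close> packets of the root color and \<open>K\<close> packets spread over the other colors in proportion to
  their prices, with tight deadlines at the end of the period. Either no further packets arrive,
  and then the optimum serves everything; or a flood of root packets fills all later slots, and
  then the optimum never leaves the root color. An algorithm that misses few deadlines cannot work
  far ahead, so it loses \<open>\<Omega>(x)\<close> slots on transitions in every other period. With
  \<open>K\<close> of order \<open>max x (sqrt (x L))\<close> and of order \<open>K / x\<close> periods, it loses \<open>\<Omega>(K)\<close> packets
  out of \<open>O(max x L)\<close> in one of the two cases.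
\<close>

text \<open>An algorithm is free to choose which colors it serves in a period, so a bound on the
  cost of one full tour is too weak: the charge has to be additive over colors, and packet numbers
  have to be proportional to it. Dual prices provide this, and as the assignment problem has
  integral duals they can be used as packet numbers, up to the common factor \<open>n\<close>. The
  raw prices have two defects. They may be negative or exceed the cost of a roundtrip to a single
  color, hence the root of minimum price and the truncation. And tours may cost far more than the
  prices charge, so that the transitions allowed to the optimum would dwarf the guaranteed loss,
  hence the extremal subset with its rate \<open>a\<close>. All packets except the flood are
  released in slot 1, so the algorithm lacks a single bit of information. Under the flood no
  deadline exceeds \<open>E\<close> and the optimum uses every slot up to \<open>E\<close>, so that
  a slot wasted earlier is never made up for. Both claims follow from one bound, in which the loss
  is proportional to any \<open>f\<close> in [0, 4] with
  \<open>f^2 \<le> \<gamma> / ln C\<close>.\<close>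

fun walk_weight :: "('a \<Rightarrow> 'a \<Rightarrow> 'b::comm_monoid_add) \<Rightarrow> 'a list \<Rightarrow> 'b" where
  "walk_weight d (x # y # zs) = d x y + walk_weight d (y # zs)"
| "walk_weight d [x] = 0"
| "walk_weight d [] = 0"

lemma walk_weight_append:
  "walk_weight d (xs @ y # zs) = walk_weight d (xs @ [y]) + walk_weight d (y # zs)"
proof (induction xs)
  case (Cons x xs)
  then show ?case by (cases xs) (auto simp: add.assoc)
qed simp

lemma walk_weight_Cons:
  "zs \<noteq> [] \<Longrightarrow> walk_weight d (x # zs) = d x (hd zs) + walk_weight d zs"
  by (cases zs) auto

lemma walk_weight_conv_sum:
  "walk_weight d xs = (\<Sum>i<length xs - 1. d (xs ! i) (xs ! Suc i))"
proof (induction xs)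
  case (Cons x xs)
  show ?case
  proof (cases xs)
    case (Cons y ys)
    then have "walk_weight d (x # xs) = d x y + (\<Sum>i<length ys. d (xs ! i) (xs ! Suc i))"
      using Cons.IH by simp
    also have "\<dots> = (\<Sum>i<Suc (length ys). d ((x # xs) ! i) ((x # xs) ! Suc i))"
      unfolding sum.lessThan_Suc_shift using Cons by simp
    finally show ?thesis using Cons by simp
  qed simp
qed simp

lemma closed_walk_weight_conv_sum:
  assumes "xs \<noteq> []"
  shows "walk_weight d (xs @ [hd xs]) =
    (\<Sum>i<length xs. d (xs ! i) (xs ! (Suc i mod length xs)))"
proof -
  have "d ((xs @ [hd xs]) ! i) ((xs @ [hd xs]) ! Suc i) = d (xs ! i) (xs ! (Suc i mod length xs))"
    if "i < length xs" for i
  proof (cases "Suc i = length xs")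
    case True
    then show ?thesis using assms that by (simp add: nth_append hd_conv_nth)
  next
    case False
    then show ?thesis using that by (simp add: nth_append)
  qed
  then show ?thesis by (simp add: walk_weight_conv_sum)
qed

text \<open>Bridge between walks, in which schedules are measured, and permutations, in which
  duality is stated: \<open>cycle_of_list\<close> sends each entry to its cyclic successor.\<close>

lemma closed_walk_weight_conv_cycle:
  assumes "distinct xs" "xs \<noteq> []"
  shows "walk_weight d (xs @ [hd xs]) = (\<Sum>x\<in>set xs. d x (cycle_of_list xs x))"
proof -
  have rot: "map (cycle_of_list xs) xs = rotate 1 xs"
    using cyclic_rotation[OF assms(1), of 1] by simp
  have "cycle_of_list xs (xs ! i) = xs ! (Suc i mod length xs)" if "i < length xs" for i
    using arg_cong[OF rot, of "\<lambda>l. l ! i"] that nth_rotate[of i xs 1] by simp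
  then have "walk_weight d (xs @ [hd xs]) =
      (\<Sum>i<length xs. d (xs ! i) (cycle_of_list xs (xs ! i)))"
    by (simp add: closed_walk_weight_conv_sum[OF assms(2)])
  also have "\<dots> = (\<Sum>x\<leftarrow>xs. d x (cycle_of_list xs x))"
    by (simp add: sum_list_sum_nth lessThan_atLeast0)
  also have "\<dots> = (\<Sum>x\<in>set xs. d x (cycle_of_list xs x))"
    using sum_list_distinct_conv_sum_set[OF assms(1)] by blast
  finally show ?thesis .
qed

section \<open>Integral duality for the assignment problem\<close>

text \<open>Without negative cycles, shortest distinct paths are shortest walks.\<close>

lemma no_negative_cycle_potential:
  fixes e :: "'a \<Rightarrow> 'a \<Rightarrow> int"
  assumes fin: "finite U"
    and cyc: "\<And>bs. \<lbrakk>distinct bs; bs \<noteq> []; set bs \<subseteq> U\<rbrakk> \<Longrightarrow> 0 \<le> walk_weight e (bs @ [hd bs])"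
  obtains \<phi> where "\<And>a b. \<lbrakk>a \<in> U; b \<in> U\<rbrakk> \<Longrightarrow> \<phi> b \<le> \<phi> a + e a b"
proof -
  \<comment> \<open>Paths may start anywhere in \<open>U\<close>, which has the effect of an
    auxiliary source joined to every vertex at cost 0.\<close>
  define P where "P b = {bs. distinct bs \<and> set bs \<subseteq> U \<and> bs \<noteq> [] \<and> last bs = b}" for b
  define \<phi> where "\<phi> b = Min (walk_weight e ` P b)" for b
  have finP: "finite (P b)" for b
  proof (rule finite_subset)
    show "P b \<subseteq> {xs. set xs \<subseteq> U \<and> length xs \<le> card U}"
      by (auto simp: P_def) (metis card_mono distinct_card fin)
    show "finite {xs. set xs \<subseteq> U \<and> length xs \<le> card U}"
      by (rule finite_lists_length_le[OF fin])
  qed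
  have \<phi>_le: "\<phi> b \<le> walk_weight e bs" if "bs \<in> P b" for b bs
    unfolding \<phi>_def using finP that by simp
  have "\<phi> b \<le> \<phi> a + e a b" if "a \<in> U" "b \<in> U" for a b
  proof -
    have "[a] \<in> P a" using that by (simp add: P_def)
    then have "\<phi> a \<in> walk_weight e ` P a"
      unfolding \<phi>_def using finP by (intro Min_in) auto
    then obtain bs where bs: "bs \<in> P a" "\<phi> a = walk_weight e bs" by auto
    then have "bs = butlast bs @ [a]"
      unfolding P_def by (metis (mono_tags) append_butlast_last_id mem_Collect_eq)
    then obtain cs where "bs = cs @ [a]" ..
    then have ext: "walk_weight e (bs @ [b]) = \<phi> a + e a b"
      using walk_weight_append[of e cs a "[b]"] bs by simp
    show ?thesis
    proof (cases "b \<in> set bs")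
      case False
      then have "bs @ [b] \<in> P b" using bs that by (auto simp: P_def)
      then show ?thesis using \<phi>_le ext by fastforce
    next
      case True
      \<comment> \<open>Appending \<open>b\<close> would close a cycle. Cutting that cycle off
        leaves a path to \<open>b\<close> that is no heavier, as the cycle is nonnegative.\<close>
      then obtain us vs where split: "bs = us @ b # vs" by (meson split_list)
      then have "us @ [b] \<in> P b" using bs by (auto simp: P_def)
      then have le: "\<phi> b \<le> walk_weight e (us @ [b])" by (rule \<phi>_le)
      have "0 \<le> walk_weight e ((b # vs) @ [b])"
        using cyc[of "b # vs"] bs split by (auto simp: P_def)
      moreover have "walk_weight e (bs @ [b]) =
          walk_weight e (us @ [b]) + walk_weight e ((b # vs) @ [b])"
        using walk_weight_append[of e us b "vs @ [b]"] split by simp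
      ultimately show ?thesis using le ext by linarith
    qed
  qed
  then show thesis by (rule that)
qed

text \<open>Optimality of \<open>\<pi>\<close> excludes negative cycles in the exchange graph, where
  \<open>e a b\<close> is the change in cost when the row matched to \<open>a\<close> moves to
  \<open>b\<close>. A potential of this graph is an optimal dual solution, integral because shortest
  path lengths are.\<close>

lemma assignment_duality:
  fixes c :: "'a \<Rightarrow> 'a \<Rightarrow> int"
  assumes fin: "finite U"
  obtains \<pi> \<alpha> \<beta> where "\<pi> permutes U"
    "\<And>u v. \<lbrakk>u \<in> U; v \<in> U\<rbrakk> \<Longrightarrow> \<alpha> u + \<beta> v \<le> c u v"
    "\<And>u. u \<in> U \<Longrightarrow> \<alpha> u + \<beta> (\<pi> u) = c u (\<pi> u)"
proof -
  define W where "W \<pi> = (\<Sum>u\<in>U. c u (\<pi> u))" for \<pi>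
  have "finite {\<pi>. \<pi> permutes U}" by (rule finite_permutations[OF fin])
  moreover have "{\<pi>. \<pi> permutes U} \<noteq> {}" using permutes_id by blast
  ultimately obtain \<pi> where \<pi>: "\<pi> permutes U" and min: "\<And>\<pi>'. \<pi>' permutes U \<Longrightarrow> W \<pi> \<le> W \<pi>'"
    using ex_min_if_finite[of "W ` {\<pi>. \<pi> permutes U}"]
    by (smt (verit) arg_min_if_finite(1) arg_min_least mem_Collect_eq)
  define e where "e a b = c (inv \<pi> a) b - c (inv \<pi> a) a" for a b
  have "0 \<le> walk_weight e (bs @ [hd bs])"
    if bs: "distinct bs" "bs \<noteq> []" "set bs \<subseteq> U" for bs
  proof -
    define \<sigma> where "\<sigma> = cycle_of_list bs"
    have \<sigma>: "\<sigma> permutes U"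
      unfolding \<sigma>_def by (rule permutes_subset[OF cycle_permutes bs(3)])
    have "walk_weight e (bs @ [hd bs]) = (\<Sum>b\<in>set bs. e b (\<sigma> b))"
      unfolding \<sigma>_def by (rule closed_walk_weight_conv_cycle[OF bs(1,2)])
    also have "\<dots> = (\<Sum>b\<in>U. e b (\<sigma> b))"
      using bs(3) fin by (intro sum.mono_neutral_left) (auto simp: e_def \<sigma>_def id_outside_supp)
    also have "\<dots> = (\<Sum>u\<in>U. e (\<pi> u) (\<sigma> (\<pi> u)))"
      by (rule sum.reindex_bij_betw[OF permutes_imp_bij[OF \<pi>], symmetric])
    also have "\<dots> = W (\<sigma> \<circ> \<pi>) - W \<pi>"
      unfolding W_def e_def by (simp add: permutes_inverses(2)[OF \<pi>] sum_subtractf)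
    also have "\<dots> \<ge> 0"
      using min[OF permutes_compose[OF \<pi> \<sigma>]] by simp
    finally show ?thesis .
  qed
  then obtain \<phi> where \<phi>: "\<And>a b. \<lbrakk>a \<in> U; b \<in> U\<rbrakk> \<Longrightarrow> \<phi> b \<le> \<phi> a + e a b"
    using no_negative_cycle_potential[OF fin, of e] by metis
  show thesis
  proof (rule that[OF \<pi>, of "\<lambda>u. c u (\<pi> u) - \<phi> (\<pi> u)" \<phi>])
    show "c u (\<pi> u) - \<phi> (\<pi> u) + \<phi> v \<le> c u v" if "u \<in> U" "v \<in> U" for u v
      using \<phi>[of "\<pi> u" v] that permutes_in_image[OF \<pi>]
      by (simp add: e_def permutes_inverses(2)[OF \<pi>])
  qed simp
qed

text \<open>The diagonal is priced out, so that the optimal permutation has no fixed points.\<close>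

lemma cycle_cover_duality:
  fixes d :: "'a \<Rightarrow> 'a \<Rightarrow> nat"
  assumes fin: "finite U" and card: "2 \<le> card U"
  obtains \<pi> p where "\<pi> permutes U" "\<And>u. u \<in> U \<Longrightarrow> \<pi> u \<noteq> u"
    "(\<Sum>u\<in>U. p u) = int (\<Sum>u\<in>U. d u (\<pi> u))"
    "\<And>xs. \<lbrakk>distinct xs; set xs \<subseteq> U; 2 \<le> length xs\<rbrakk> \<Longrightarrow>
      (\<Sum>x\<in>set xs. p x) \<le> int (walk_weight d (xs @ [hd xs]))"
proof -
  define B where "B = 1 + (\<Sum>u\<in>U. \<Sum>v\<in>U. int (d u v))"
  define c where "c u v = (if u = v then B else int (d u v))" for u v
  obtain \<pi> \<alpha> \<beta> where \<pi>: "\<pi> permutes U"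
    and le: "\<And>u v. \<lbrakk>u \<in> U; v \<in> U\<rbrakk> \<Longrightarrow> \<alpha> u + \<beta> v \<le> c u v"
    and eq: "\<And>u. u \<in> U \<Longrightarrow> \<alpha> u + \<beta> (\<pi> u) = c u (\<pi> u)"
    using assignment_duality[OF fin, of c] by metis
  \<comment> \<open>A permutation only rearranges the column duals, so the row dual and the column
    dual of a color merge into one price \<open>\<alpha> u + \<beta> u\<close>.\<close>
  have sumperm: "(\<Sum>u\<in>U. \<alpha> u + \<beta> (\<sigma> u)) = (\<Sum>u\<in>U. \<alpha> u + \<beta> u)" if "\<sigma> permutes U" for \<sigma>
    using sum.reindex_bij_betw[OF permutes_imp_bij[OF that], of \<beta>] by (simp add: sum.distrib)
  have cover: "(\<Sum>x\<in>set xs. \<alpha> x + \<beta> x) \<le> int (walk_weight d (xs @ [hd xs])) \<and>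
      (\<forall>x\<in>set xs. cycle_of_list xs x \<noteq> x)"
    if xs: "distinct xs" "set xs \<subseteq> U" "2 \<le> length xs" for xs
  proof -
    define \<sigma> where "\<sigma> = cycle_of_list xs"
    have ne: "xs \<noteq> []" using xs by auto
    have \<sigma>: "\<sigma> permutes set xs" unfolding \<sigma>_def by (rule cycle_permutes)
    have nofix: "\<sigma> x \<noteq> x" if x: "x \<in> set xs" for x
    proof -
      obtain i where i: "i < length xs" "x = xs ! i" using x by (auto simp: in_set_conv_nth)
      have "\<sigma> x = xs ! (Suc i mod length xs)"
        using arg_cong[OF cyclic_rotation[OF xs(1), of 1], of "\<lambda>l. l ! i"] i nth_rotate[of i xs 1]
        by (simp add: \<sigma>_def)
      moreover have "Suc i mod length xs \<noteq> i"
        using i xs(3) by (cases "Suc i = length xs") auto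
      ultimately show ?thesis using i xs(1) nth_eq_iff_index_eq[of xs] ne by fastforce
    qed
    have "(\<Sum>x\<in>set xs. \<alpha> x + \<beta> x) = (\<Sum>x\<in>set xs. \<alpha> x + \<beta> (\<sigma> x))"
      using sum.reindex_bij_betw[OF permutes_imp_bij[OF \<sigma>], of \<beta>] by (simp add: sum.distrib)
    also have "\<dots> \<le> (\<Sum>x\<in>set xs. int (d x (\<sigma> x)))"
    proof (rule sum_mono)
      fix x assume x: "x \<in> set xs"
      then have "\<sigma> x \<in> U" using permutes_in_image[OF \<sigma>] xs(2) by blast
      then show "\<alpha> x + \<beta> (\<sigma> x) \<le> int (d x (\<sigma> x))"
        using le[of x "\<sigma> x"] x xs(2) nofix[OF x] by (auto simp: c_def)
    qed
    also have "\<dots> = int (walk_weight d (xs @ [hd xs]))"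
      by (simp add: closed_walk_weight_conv_cycle[OF xs(1) ne] \<sigma>_def)
    finally show ?thesis using nofix by (auto simp: \<sigma>_def)
  qed
  have opt: "(\<Sum>u\<in>U. c u (\<pi> u)) = (\<Sum>u\<in>U. \<alpha> u + \<beta> u)"
    using sumperm[OF \<pi>] eq by simp
  \<comment> \<open>A cycle through all of \<open>U\<close> keeps the dual value, and with it the
    cost of \<open>\<pi>\<close>, below the cost of a single fixed point.\<close>
  have "(\<Sum>u\<in>U. \<alpha> u + \<beta> u) < B"
  proof -
    obtain us where us: "distinct us" "set us = U" using finite_distinct_list[OF fin] by blast
    then have len: "2 \<le> length us" using card distinct_card by fastforce
    define \<sigma> where "\<sigma> = cycle_of_list us"
    have \<sigma>: "\<sigma> permutes U" unfolding \<sigma>_def using cycle_permutes[of us] us by simp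
    have "(\<Sum>u\<in>U. \<alpha> u + \<beta> u) \<le> int (walk_weight d (us @ [hd us]))"
      using cover[OF us(1) _ len] us by simp
    also have "\<dots> = (\<Sum>u\<in>U. int (d u (\<sigma> u)))"
      using closed_walk_weight_conv_cycle[OF us(1), of d] us len
      by (cases us) (simp_all add: \<sigma>_def)
    also have "\<dots> \<le> (\<Sum>u\<in>U. \<Sum>v\<in>U. int (d u v))"
      using permutes_in_image[OF \<sigma>] fin
      by (intro sum_mono member_le_sum) auto
    finally show ?thesis by (simp add: B_def)
  qed
  moreover have "B \<ge> 0" "\<And>u v. c u v \<ge> 0"
    by (auto simp: B_def c_def intro!: add_nonneg_nonneg sum_nonneg)
  ultimately have nofix: "\<pi> u \<noteq> u" if "u \<in> U" for u
    using member_le_sum[OF that, of "\<lambda>u. c u (\<pi> u)"] that fin opt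
    by (auto simp: c_def split: if_splits)
  show thesis
  proof (rule that[OF \<pi> nofix, of "\<lambda>u. \<alpha> u + \<beta> u"])
    show "(\<Sum>u\<in>U. \<alpha> u + \<beta> u) = int (\<Sum>u\<in>U. d u (\<pi> u))"
    proof -
      have "(\<Sum>u\<in>U. \<alpha> u + \<beta> u) = (\<Sum>u\<in>U. int (d u (\<pi> u)))"
        unfolding opt[symmetric] using nofix by (intro sum.cong) (fastforce simp: c_def)+
      then show ?thesis by simp
    qed
    show "(\<Sum>x\<in>set xs. \<alpha> x + \<beta> x) \<le> int (walk_weight d (xs @ [hd xs]))"
      if "distinct xs" "set xs \<subseteq> U" "2 \<le> length xs" for xs
      using cover[OF that] by blast
  qed
qed

section \<open>Tours from cycle covers\<close>

lemma splice_closed_walk: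
  assumes ws: "ws \<noteq> []" "hd ws = last ws" and c: "c \<in> set ws"
  obtains ws' where "ws' \<noteq> []" "hd ws' = last ws'" "set ws' = set ws \<union> set (c # ys)"
    "walk_weight d ws' = walk_weight d ws + walk_weight d (c # ys @ [c])"
proof -
  obtain us vs where split: "ws = us @ c # vs" using c by (meson split_list)
  show thesis
  proof (rule that[of "us @ (c # ys) @ c # vs"])
    show "hd (us @ (c # ys) @ c # vs) = last (us @ (c # ys) @ c # vs)"
      using ws split by (cases us) auto
    show "set (us @ (c # ys) @ c # vs) = set ws \<union> set (c # ys)" using split by auto
    have "walk_weight d (us @ (c # ys) @ c # vs) =
        walk_weight d (us @ [c]) + walk_weight d (c # ys @ c # vs)"
      using walk_weight_append[of d us c "ys @ c # vs"] by simp
    also have "walk_weight d (c # ys @ c # vs) =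
        walk_weight d (c # ys @ [c]) + walk_weight d (c # vs)"
      using walk_weight_append[of d "c # ys" c vs] by simp
    finally show "walk_weight d (us @ (c # ys) @ c # vs) =
        walk_weight d ws + walk_weight d (c # ys @ [c])"
      using walk_weight_append[of d us c vs] split by (simp add: add_ac)
  qed simp
qed

text \<open>One representative per cycle suffices, and every cycle has at least two elements.\<close>

lemma cycle_representatives:
  fixes d :: "'a \<Rightarrow> 'a \<Rightarrow> nat"
  assumes "cycle_decomp S p" "\<forall>u\<in>S. p u \<noteq> u"
  shows "\<exists>R\<subseteq>S. 2 * card R \<le> card S \<and> (S \<noteq> {} \<longrightarrow> R \<noteq> {}) \<and>
    (\<forall>ws. ws \<noteq> [] \<longrightarrow> hd ws = last ws \<longrightarrow> R \<subseteq> set ws \<longrightarrow>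
      (\<exists>ws'. ws' \<noteq> [] \<and> hd ws' = last ws' \<and> set ws' = set ws \<union> S \<and>
        walk_weight d ws' = walk_weight d ws + (\<Sum>u\<in>S. d u (p u))))"
  using assms
proof (induction rule: cycle_decomp.induct)
  case empty
  then show ?case by auto
next
  case (comp I p cs)
  show ?case
  proof (cases cs)
    case Nil
    then show ?thesis using comp by simp
  next
    case (Cons u us)
    have finI: "finite I" and pI: "p permutes I"
      using comp.hyps(1)
      by (induction rule: cycle_decomp.induct)
        (auto simp: permutes_id
          intro!: permutes_compose permutes_subset[OF cycle_permutes]
          intro: permutes_subset)
    have q_I: "(cycle_of_list cs \<circ> p) x = p x" if "x \<in> I" for x
      using that permutes_in_image[OF pI] comp.hyps(3) id_outside_supp[of "p x" cs] by auto
    have q_cs: "(cycle_of_list cs \<circ> p) x = cycle_of_list cs x" if "x \<in> set cs" for x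
    proof -
      have "x \<notin> I" using that comp.hyps(3) by blast
      then show ?thesis by (simp add: permutes_not_in[OF pI])
    qed
    have nofix: "\<forall>x\<in>I. p x \<noteq> x" using comp.prems q_I by (metis UnI2)
    obtain R where R: "R \<subseteq> I" "2 * card R \<le> card I"
      and ext: "\<forall>ws. ws \<noteq> [] \<longrightarrow> hd ws = last ws \<longrightarrow> R \<subseteq> set ws \<longrightarrow>
        (\<exists>ws'. ws' \<noteq> [] \<and> hd ws' = last ws' \<and> set ws' = set ws \<union> I \<and>
          walk_weight d ws' = walk_weight d ws + (\<Sum>u\<in>I. d u (p u)))"
      using comp.IH[OF nofix] by (elim exE conjE)
    have "us \<noteq> []"
      using bspec[OF comp.prems, of u] q_cs[of u] Cons by auto
    then have "2 \<le> card (set cs)"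
      using Cons comp.hyps(2) by (cases us) auto
    then have card: "card I + 2 \<le> card (set cs \<union> I)"
      using comp.hyps(3) finI by (simp add: card_Un_disjoint)
    have uR: "u \<notin> R" using R(1) comp.hyps(3) Cons by auto
    have "2 * card (insert u R) \<le> card (set cs \<union> I)"
      using card R(2) finite_subset[OF R(1) finI] uR by simp
    moreover have "\<exists>ws'. ws' \<noteq> [] \<and> hd ws' = last ws' \<and> set ws' = set ws \<union> (set cs \<union> I) \<and>
        walk_weight d ws' =
          walk_weight d ws + (\<Sum>u\<in>set cs \<union> I. d u ((cycle_of_list cs \<circ> p) u))"
      if ws: "ws \<noteq> []" "hd ws = last ws" "insert u R \<subseteq> set ws" for ws
    proof -
      obtain ws1 where ws1: "ws1 \<noteq> []" "hd ws1 = last ws1" "set ws1 = set ws \<union> I"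
        "walk_weight d ws1 = walk_weight d ws + (\<Sum>u\<in>I. d u (p u))"
        using ext[rule_format, OF ws(1,2)] ws(3) by auto
      \<comment> \<open>The representative \<open>u\<close> lies on the walk, which can therefore go
        once round the new cycle and resume.\<close>
      have "u \<in> set ws1" using ws ws1 by auto
      then obtain ws2 where ws2: "ws2 \<noteq> []" "hd ws2 = last ws2"
        "set ws2 = set ws1 \<union> set (u # us)"
        "walk_weight d ws2 = walk_weight d ws1 + walk_weight d (u # us @ [u])"
        using splice_closed_walk[OF ws1(1,2), of u us d] by metis
      have "walk_weight d (u # us @ [u]) = (\<Sum>x\<in>set cs. d x (cycle_of_list cs x))"
        using closed_walk_weight_conv_cycle[OF comp.hyps(2), of d] Cons by simp
      also have "\<dots> = (\<Sum>x\<in>set cs. d x ((cycle_of_list cs \<circ> p) x))"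
        using q_cs by (intro sum.cong) auto
      finally have "walk_weight d ws2 = walk_weight d ws +
          ((\<Sum>x\<in>set cs. d x ((cycle_of_list cs \<circ> p) x)) +
           (\<Sum>x\<in>I. d x ((cycle_of_list cs \<circ> p) x)))"
        using ws1(4) ws2(4) q_I by (simp add: add_ac)
      also have "\<dots> = walk_weight d ws + (\<Sum>u\<in>set cs \<union> I. d u ((cycle_of_list cs \<circ> p) u))"
        using comp.hyps(3) finI by (subst sum.union_disjoint) auto
      finally show ?thesis using ws2 ws1 Cons by (intro exI[of _ ws2]) auto
    qed
    ultimately show ?thesis
      using R(1) Cons by (intro exI[of _ "insert u R"]) auto
  qed
qed

text \<open>Each round costs at most \<open>M\<close> and at least halves the colors still to be
  joined, so after \<open>k\<close> rounds one color is left. Splicing the covers back in yields a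
  tour that may revisit colors.\<close>

lemma tour_from_cycle_covers:
  fixes d :: "'a \<Rightarrow> 'a \<Rightarrow> nat"
  assumes "finite U" "U \<noteq> {}" "card U \<le> 2 ^ k"
    and "\<And>U'. \<lbrakk>U' \<subseteq> U; 2 \<le> card U'\<rbrakk> \<Longrightarrow>
      \<exists>\<pi>. \<pi> permutes U' \<and> (\<forall>u\<in>U'. \<pi> u \<noteq> u) \<and> (\<Sum>u\<in>U'. d u (\<pi> u)) \<le> M"
    and "\<And>u. u \<in> U \<Longrightarrow> d u u = 0"
  shows "\<exists>ws. ws \<noteq> [] \<and> hd ws = last ws \<and> set ws = U \<and> walk_weight d ws \<le> k * M"
  using assms
proof (induction k arbitrary: U)
  case 0
  then have "card U = 1" by (metis One_nat_def card_gt_0_iff le_antisym Suc_leI power_0)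
  then obtain u where "U = {u}" by (auto simp: card_1_singleton_iff)
  then show ?case by (intro exI[of _ "[u]"]) simp
next
  case (Suc k)
  show ?case
  proof (cases "2 \<le> card U")
    case False
    then have "card U \<le> 2 ^ k" by (metis One_nat_def le_trans not_less_eq_eq numeral_2_eq_2 one_le_numeral one_le_power)
    then obtain ws where "ws \<noteq> []" "hd ws = last ws" "set ws = U" "walk_weight d ws \<le> k * M"
      using Suc.IH[OF Suc.prems(1,2) _ Suc.prems(4,5)] by blast
    then show ?thesis by (intro exI[of _ ws]) auto
  next
    case True
    then obtain \<pi> where \<pi>: "\<pi> permutes U" "\<forall>u\<in>U. \<pi> u \<noteq> u" "(\<Sum>u\<in>U. d u (\<pi> u)) \<le> M"
      using Suc.prems(4) by blast
    obtain R where R: "R \<subseteq> U" "2 * card R \<le> card U" "U \<noteq> {} \<longrightarrow> R \<noteq> {}"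
      and ext: "\<forall>ws. ws \<noteq> [] \<longrightarrow> hd ws = last ws \<longrightarrow> R \<subseteq> set ws \<longrightarrow>
        (\<exists>ws'. ws' \<noteq> [] \<and> hd ws' = last ws' \<and> set ws' = set ws \<union> U \<and>
          walk_weight d ws' = walk_weight d ws + (\<Sum>u\<in>U. d u (\<pi> u)))"
      using cycle_representatives[OF cycle_decomposition[OF \<pi>(1) Suc.prems(1)] \<pi>(2), of d]
      by (elim exE conjE)
    have "\<exists>ws. ws \<noteq> [] \<and> hd ws = last ws \<and> set ws = R \<and> walk_weight d ws \<le> k * M"
    proof (rule Suc.IH)
      show "finite R" using R(1) Suc.prems(1) finite_subset by blast
      show "card R \<le> 2 ^ k" using R(2) Suc.prems(3) by simp
      show "\<exists>\<pi>. \<pi> permutes U' \<and> (\<forall>u\<in>U'. \<pi> u \<noteq> u) \<and> (\<Sum>u\<in>U'. d u (\<pi> u)) \<le> M"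
        if "U' \<subseteq> R" "2 \<le> card U'" for U'
        using Suc.prems(4)[OF subset_trans[OF that(1) R(1)] that(2)] .
      show "R \<noteq> {}" using R(3) Suc.prems(2) by blast
      show "d u u = 0" if "u \<in> R" for u using Suc.prems(5) that R(1) by blast
    qed
    then obtain ws where ws: "ws \<noteq> []" "hd ws = last ws" "set ws = R" "walk_weight d ws \<le> k * M"
      by (elim exE conjE)
    have "set ws \<union> U = U" using ws(3) R(1) by blast
    then obtain ws' where "ws' \<noteq> []" "hd ws' = last ws'" "set ws' = U"
      "walk_weight d ws' = walk_weight d ws + (\<Sum>u\<in>U. d u (\<pi> u))"
      using ext[rule_format, OF ws(1,2)] ws(3) by auto
    then show ?thesis using ws(4) \<pi>(3) by (intro exI[of _ ws']) auto
  qed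
qed

section \<open>Walks and the triangle inequality\<close>

definition rooted_tour :: "('a \<Rightarrow> 'a \<Rightarrow> 'b::comm_monoid_add) \<Rightarrow> 'a \<Rightarrow> 'a list \<Rightarrow> 'b" where
  "rooted_tour d r vs = walk_weight d (r # vs @ [r])"

text \<open>Shortcutting: the triangle inequality drops the skipped vertices one at a time. The end
  \<open>e\<close> is kept, so that closed walks through a root are covered.\<close>

lemma walk_weight_subseq:
  fixes d :: "'a \<Rightarrow> 'a \<Rightarrow> nat"
  assumes "subseq vs ys" "insert a (set ys) \<subseteq> A" "e \<in> A"
    and tri: "\<And>x y z. \<lbrakk>x \<in> A; y \<in> A; z \<in> A\<rbrakk> \<Longrightarrow> d x z \<le> d x y + d y z"
  shows "walk_weight d (a # vs @ [e]) \<le> walk_weight d (a # ys @ [e])"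
  using assms(1,2)
proof (induction arbitrary: a rule: list_emb.induct)
  case (list_emb_Nil ys)
  then show ?case
  proof (induction ys arbitrary: a)
    case (Cons y ys)
    have "d a e \<le> d a y + d y e" using Cons.prems assms(3) tri by auto
    then show ?case using Cons.IH[of y] Cons.prems by auto
  qed simp
next
  case (list_emb_Cons xs ys y)
  have "walk_weight d (a # xs @ [e]) \<le> walk_weight d (a # ys @ [e])"
    using list_emb_Cons by auto
  also have "\<dots> \<le> d a y + walk_weight d (y # ys @ [e])"
  proof -
    have "hd (ys @ [e]) \<in> A" using list_emb_Cons.prems assms(3) by (cases ys) auto
    then have "d a (hd (ys @ [e])) \<le> d a y + d y (hd (ys @ [e]))"
      using list_emb_Cons.prems by (intro tri) auto
    then show ?thesis by (simp add: walk_weight_Cons)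
  qed
  finally show ?case by simp
next
  case (list_emb_Cons2 x y xs ys)
  then show ?case by auto
qed

lemma rooted_tour_simple:
  fixes d :: "'a \<Rightarrow> 'a \<Rightarrow> nat"
  assumes "insert r (set ys) \<subseteq> A"
    and tri: "\<And>x y z. \<lbrakk>x \<in> A; y \<in> A; z \<in> A\<rbrakk> \<Longrightarrow> d x z \<le> d x y + d y z"
  obtains vs where "distinct vs" "set vs = set ys - {r}" "rooted_tour d r vs \<le> rooted_tour d r ys"
proof (rule that[of "remdups (filter (\<lambda>x. x \<noteq> r) ys)"])
  have "subseq (remdups zs) zs" for zs :: "'a list" by (induction zs) auto
  then have "subseq (remdups (filter (\<lambda>x. x \<noteq> r) ys)) ys"
    by (rule subseq_order.trans[OF _ subseq_filter_left])
  then show "rooted_tour d r (remdups (filter (\<lambda>x. x \<noteq> r) ys)) \<le> rooted_tour d r ys"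
    unfolding rooted_tour_def using assms by (intro walk_weight_subseq[where A = A]) auto
qed auto

text \<open>Two roundtrips are joined at the root and the visit in the middle is skipped. This makes
  the cheapest roundtrip subadditive in the set of colors.\<close>

lemma rooted_tour_append:
  fixes d :: "'a \<Rightarrow> 'a \<Rightarrow> nat"
  assumes "insert r (set us \<union> set vs) \<subseteq> A"
    and tri: "\<And>x y z. \<lbrakk>x \<in> A; y \<in> A; z \<in> A\<rbrakk> \<Longrightarrow> d x z \<le> d x y + d y z"
  shows "rooted_tour d r (us @ vs) \<le> rooted_tour d r us + rooted_tour d r vs"
proof -
  have "rooted_tour d r (us @ vs) \<le> walk_weight d (r # (us @ [r] @ vs) @ [r])"
    unfolding rooted_tour_def using assms
    by (intro walk_weight_subseq[where A = A]) (auto intro: list_emb_append_mono)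
  also have "\<dots> = rooted_tour d r us + rooted_tour d r vs"
    using walk_weight_append[of d "r # us" r "vs @ [r]"] by (simp add: rooted_tour_def)
  finally show ?thesis .
qed

lemma finite_attains_max:
  fixes f :: "'a \<Rightarrow> 'b::linorder"
  assumes "finite F" "F \<noteq> {}"
  shows "\<exists>x\<in>F. \<forall>y\<in>F. f y \<le> f x"
proof -
  have "Max (f ` F) \<in> f ` F" using assms by (intro Max_in) auto
  then obtain x where "x \<in> F" "f x = Max (f ` F)" by auto
  then show ?thesis using assms(1) by (intro bexI[of _ x]) auto
qed

section \<open>A set of colors that is uniformly expensive to visit\<close>

text \<open>The set \<open>U\<close> maximizes the product of its weight and its cheapest cost per unit of weight.
  Removing cheap parts from \<open>U\<close> cannot raise that product, so half of \<open>U\<close> is covered at twice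
  the cheapest rate.\<close>

lemma uniformly_expensive_subset:
  fixes cost q :: "'a set \<Rightarrow> real"
  assumes fin: "finite Z" and ne: "Z \<noteq> {}"
    and q_pos: "\<And>S. \<lbrakk>S \<subseteq> Z; S \<noteq> {}\<rbrakk> \<Longrightarrow> 0 < q S"
    and q_add: "\<And>S S'. \<lbrakk>S \<subseteq> Z; S' \<subseteq> Z; S \<inter> S' = {}\<rbrakk> \<Longrightarrow> q (S \<union> S') = q S + q S'"
    and cost_ge: "\<And>S. \<lbrakk>S \<subseteq> Z; S \<noteq> {}\<rbrakk> \<Longrightarrow> q S \<le> cost S"
    and cost_add: "\<And>S S'. \<lbrakk>S \<subseteq> Z; S' \<subseteq> Z; S \<noteq> {}; S' \<noteq> {}; S \<inter> S' = {}\<rbrakk> \<Longrightarrow>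
      cost (S \<union> S') \<le> cost S + cost S'"
  obtains V a where "V \<subseteq> Z" "V \<noteq> {}" "1 \<le> a" "q Z \<le> 2 * (a * q V)" "cost V \<le> 2 * a * q V"
    "\<And>S. \<lbrakk>S \<subseteq> V; S \<noteq> {}\<rbrakk> \<Longrightarrow> a * q S \<le> cost S"
proof -
  define rate where "rate U = Min ((\<lambda>S. cost S / q S) ` (Pow U - {{}}))" for U
  have rate_le: "rate U * q S \<le> cost S" if "U \<subseteq> Z" "S \<subseteq> U" "S \<noteq> {}" for U S
  proof -
    have "finite (Pow U - {{}})" using that fin finite_subset by auto
    then have "rate U \<le> cost S / q S" unfolding rate_def using that by (intro Min_le) auto
    then show ?thesis using q_pos[of S] that by (simp add: field_simps)
  qed
  have rate_attained: "\<exists>S\<subseteq>U. S \<noteq> {} \<and> cost S = rate U * q S" if "U \<subseteq> Z" "U \<noteq> {}" for U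
  proof -
    have "finite (Pow U - {{}})" using that fin finite_subset by auto
    moreover have "Pow U - {{}} \<noteq> {}" using that by auto
    ultimately have "rate U \<in> (\<lambda>S. cost S / q S) ` (Pow U - {{}})"
      unfolding rate_def by (intro Min_in) auto
    then obtain S where S: "S \<subseteq> U" "S \<noteq> {}" "rate U = cost S / q S" by auto
    moreover have "0 < q S" using S that by (intro q_pos) auto
    ultimately show ?thesis by (intro exI[of _ S]) auto
  qed
  define F where "F = Pow Z - {{}}"
  have "finite F" "F \<noteq> {}" using fin ne by (auto simp: F_def)
  then obtain U where "U \<in> F" and U_max: "\<And>U'. U' \<in> F \<Longrightarrow> rate U' * q U' \<le> rate U * q U"
    using finite_attains_max[of F "\<lambda>U. rate U * q U"] by metis
  then have U: "U \<subseteq> Z" "U \<noteq> {}" by (auto simp: F_def)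
  define a where "a = rate U"
  have qU: "0 < q U" using q_pos U by blast
  \<comment> \<open>For \<open>Z\<close> itself the maximized product is at least
    \<open>q Z\<close>, because weights never exceed costs.\<close>
  have qZ: "q Z \<le> a * q U"
  proof -
    obtain S where S: "S \<subseteq> Z" "S \<noteq> {}" "cost S = rate Z * q S"
      using rate_attained[of Z] ne by auto
    have "1 * q S \<le> rate Z * q S" using cost_ge[OF S(1,2)] unfolding S(3) mult_1 .
    then have "1 \<le> rate Z" by (rule mult_right_le_imp_le) (rule q_pos[OF S(1,2)])
    moreover have "0 \<le> q Z" using q_pos[of Z] ne by simp
    ultimately have "1 * q Z \<le> rate Z * q Z" by (rule mult_right_mono)
    then have "q Z \<le> rate Z * q Z" unfolding mult_1 .
    also have "\<dots> \<le> a * q U" unfolding a_def using ne by (intro U_max) (auto simp: F_def)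
    finally show ?thesis .
  qed
  have a1: "1 \<le> a"
  proof -
    have "q U \<le> q Z"
    proof (cases "U = Z")
      case False
      then have "0 < q (Z - U)" using U by (intro q_pos) auto
      moreover have "q (U \<union> (Z - U)) = q U + q (Z - U)"
        using U by (intro q_add) auto
      moreover have "U \<union> (Z - U) = Z" using U by auto
      ultimately show ?thesis by simp
    qed simp
    then have "1 * q U \<le> a * q U" using qZ unfolding mult_1 by linarith
    then show ?thesis using qU by (rule mult_right_le_imp_le)
  qed
  \<comment> \<open>A member of maximum cardinality replaces the result of greedily collecting cheap
    disjoint parts of \<open>U\<close>.\<close>
  define G where "G = {V. V \<subseteq> U \<and> V \<noteq> {} \<and> cost V \<le> 2 * a * q V}"
  have "finite G" unfolding G_def using finite_subset[OF U(1) fin] by simp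
  moreover have "G \<noteq> {}"
  proof -
    obtain S where S: "S \<subseteq> U" "S \<noteq> {}" "cost S = a * q S"
      using rate_attained[OF U] by (auto simp: a_def)
    have "0 < q S" using q_pos S U by blast
    then have "S \<in> G" using S a1 by (simp add: G_def)
    then show ?thesis by blast
  qed
  ultimately obtain V where "V \<in> G" and V_max: "\<And>V'. V' \<in> G \<Longrightarrow> card V' \<le> card V"
    using finite_attains_max[of G card] by metis
  then have V: "V \<subseteq> U" "V \<noteq> {}" "cost V \<le> 2 * a * q V" by (auto simp: G_def)
  have "q U \<le> 2 * q V"
  proof (rule ccontr)
    assume small: "\<not> q U \<le> 2 * q V"
    define U' where "U' = U - V"
    have UV: "U = V \<union> U'" using V by (auto simp: U'_def)
    have "q (V \<union> U') = q V + q U'" using V U by (intro q_add) (auto simp: U'_def)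
    then have "q U = q V + q U'" unfolding UV[symmetric] .
    then have U'_big: "q U < 2 * q U'" using small by simp
    have U'_ne: "U' \<noteq> {}"
    proof
      assume "U' = {}"
      then have "U = V" using UV by simp
      then show False using small qU by simp
    qed
    have U'Z: "U' \<subseteq> Z" using U by (auto simp: U'_def)
    obtain S where S: "S \<subseteq> U'" "S \<noteq> {}" "cost S = rate U' * q S"
      using rate_attained[OF U'Z U'_ne] by auto
    \<comment> \<open>The remainder carries more than half of the weight, so by the choice of
      \<open>U\<close> its rate is at most \<open>2 * a\<close>. Its cheapest part could then join
      \<open>V\<close>.\<close>
    have "rate U' * q U' \<le> a * q U"
      unfolding a_def using U'Z U'_ne by (intro U_max) (auto simp: F_def)
    also have "\<dots> \<le> (2 * a) * q U'" using U'_big a1 by simp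
    finally have "rate U' \<le> 2 * a" using q_pos[OF U'Z U'_ne] by simp
    moreover have "0 < q S" using S U'Z by (intro q_pos) auto
    ultimately have "cost S \<le> 2 * a * q S"
      using S(3) by (simp add: mult_right_mono)
    moreover have disj: "V \<inter> S = {}" "V \<subseteq> Z" "S \<subseteq> Z"
      using S(1) V(1) U(1) by (auto simp: U'_def)
    ultimately have "cost (V \<union> S) \<le> 2 * a * q V + 2 * a * q S"
      using V(3) cost_add[OF disj(2,3) V(2) S(2) disj(1)] by linarith
    then have "cost (V \<union> S) \<le> 2 * a * q (V \<union> S)"
      by (simp add: q_add[OF disj(2,3,1)] distrib_left)
    then have "V \<union> S \<in> G" using V(1,2) S(1) by (auto simp: G_def U'_def)
    from V_max[OF this] have "card (V \<union> S) \<le> card V" .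
    moreover have "card V < card (V \<union> S)"
      using disj S(2) finite_subset[OF _ fin] by (intro psubset_card_mono) auto
    ultimately show False by simp
  qed
  then have "a * q U \<le> a * (2 * q V)" using a1 by (intro mult_left_mono) auto
  then have "q Z \<le> 2 * (a * q V)" using qZ by simp
  then show thesis
    using that[of V a] V U a1 rate_le[OF U(1)] by (auto simp: a_def)
qed

text \<open>The interface to the online part, where \<open>a * (\<Sum>v\<in>set vs. q v)\<close>
  becomes the total price \<open>x\<close>. In \<open>T \<le> 4 k x\<close>, the factor
  \<open>k\<close> counts rounds of cycle covers, one factor 2 pays for giving up the root and
  truncating prices, the other for passing to the extremal subset.\<close>

lemma expensive_colors:
  fixes d :: "nat \<Rightarrow> nat \<Rightarrow> nat"
  assumes diag: "\<And>j. j < C \<Longrightarrow> d j j = 0"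
    and tri: "\<And>j k l. \<lbrakk>j < C; k < C; l < C\<rbrakk> \<Longrightarrow> d j k \<le> d j l + d l k"
    and C: "C \<le> 2 ^ k" "0 < C"
    and tsp: "\<And>ws. \<lbrakk>ws \<noteq> []; hd ws = last ws; set ws = {..<C}\<rbrakk> \<Longrightarrow> T \<le> real (walk_weight d ws)"
    and T: "0 < T"
  obtains r vs q a where "r < C" "distinct vs" "vs \<noteq> []" "set vs \<subseteq> {..<C} - {r}"
    "\<And>v. v \<in> set vs \<Longrightarrow> 1 \<le> q v" "1 \<le> a" "T \<le> 4 * real k * (a * real (\<Sum>v\<in>set vs. q v))"
    "real (rooted_tour d r vs) \<le> 2 * (a * real (\<Sum>v\<in>set vs. q v))"
    "\<And>ys. set ys \<subseteq> insert r (set vs) \<Longrightarrow>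
      a * real (\<Sum>v\<in>set ys - {r}. q v) \<le> real (rooted_tour d r ys)"
proof -
  define D where "D U \<pi> p \<longleftrightarrow> \<pi> permutes U \<and> (\<forall>u\<in>U. \<pi> u \<noteq> u) \<and>
    (\<Sum>u\<in>U. p u) = int (\<Sum>u\<in>U. d u (\<pi> u)) \<and>
    (\<forall>xs. distinct xs \<longrightarrow> set xs \<subseteq> U \<longrightarrow> 2 \<le> length xs \<longrightarrow>
      (\<Sum>x\<in>set xs. p x) \<le> int (walk_weight d (xs @ [hd xs])))" for U \<pi> and p :: "nat \<Rightarrow> int"
  define F where "F = {U. U \<subseteq> {..<C} \<and> 2 \<le> card U}"
  have "\<exists>\<pi> p. D U \<pi> p" if "U \<in> F" for U
  proof -
    have U: "finite U" "2 \<le> card U" using that finite_subset by (auto simp: F_def)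
    obtain \<pi> p where "\<pi> permutes U"
      "\<And>u. u \<in> U \<Longrightarrow> \<pi> u \<noteq> u" "(\<Sum>u\<in>U. p u) = int (\<Sum>u\<in>U. d u (\<pi> u))"
      "\<And>xs. \<lbrakk>distinct xs; set xs \<subseteq> U; 2 \<le> length xs\<rbrakk> \<Longrightarrow>
        (\<Sum>x\<in>set xs. p x) \<le> int (walk_weight d (xs @ [hd xs]))"
      by (rule cycle_cover_duality[OF U, of d]) (rule that)
    then have "D U \<pi> p" unfolding D_def by simp
    then show ?thesis by blast
  qed
  then obtain \<pi> p where Dp: "\<And>U. U \<in> F \<Longrightarrow> D U (\<pi> U) (p U)" by metis
  define cc where "cc U = (\<Sum>u\<in>U. d u (\<pi> U u))" for U
  have finF: "finite F" unfolding F_def by simp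
  have "F \<noteq> {}"
  proof
    assume "F = {}"
    then have "\<not> 2 \<le> card {..<C}" by (auto simp: F_def)
    then have "C = 1" using C by simp
    then have "T \<le> real (walk_weight d [0])" by (intro tsp) auto
    then show False using T by simp
  qed
  \<comment> \<open>No round of the tour construction has to cost more than the worst cycle cover
    value \<open>M\<close>, and the dual prices of the set attaining it add up to exactly
    \<open>M\<close>.\<close>
  then obtain U where UF: "U \<in> F" and U_max: "\<And>U'. U' \<in> F \<Longrightarrow> cc U' \<le> cc U"
    using finite_attains_max[OF finF, of cc] by metis
  define M where "M = cc U"
  have "\<exists>ws. ws \<noteq> [] \<and> hd ws = last ws \<and> set ws = {..<C} \<and> walk_weight d ws \<le> k * M"
  proof (rule tour_from_cycle_covers)
    show "\<exists>\<pi>. \<pi> permutes U' \<and> (\<forall>u\<in>U'. \<pi> u \<noteq> u) \<and> (\<Sum>u\<in>U'. d u (\<pi> u)) \<le> M"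
      if "U' \<subseteq> {..<C}" "2 \<le> card U'" for U'
    proof -
      have "U' \<in> F" using that by (simp add: F_def)
      then show ?thesis using Dp[of U'] U_max[of U'] unfolding D_def M_def cc_def by blast
    qed
    show "card {..<C} \<le> 2 ^ k" "{..<C} \<noteq> {}" "finite {..<C}" using C by auto
    show "d u u = 0" if "u \<in> {..<C}" for u using diag that by simp
  qed
  then obtain ws where ws: "ws \<noteq> []" "hd ws = last ws" "set ws = {..<C}" "walk_weight d ws \<le> k * M"
    by (elim exE conjE)
  have TM: "T \<le> real k * real M"
    using tsp[OF ws(1-3)] ws(4) by (metis le_trans of_nat_le_iff of_nat_mult order_trans)
  have M1: "0 < M" using TM T by (cases M) auto
  define P where "P = p U"
  have U: "U \<subseteq> {..<C}" "2 \<le> card U" "finite U" using UF finite_subset by (auto simp: F_def)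
  have sumP: "(\<Sum>u\<in>U. P u) = int M"
    and P_le: "\<And>xs. \<lbrakk>distinct xs; set xs \<subseteq> U; 2 \<le> length xs\<rbrakk> \<Longrightarrow>
      (\<Sum>x\<in>set xs. P x) \<le> int (walk_weight d (xs @ [hd xs]))"
    using Dp[OF UF] unfolding D_def P_def M_def cc_def by blast+
  have "U \<noteq> {}" using U(2) by auto
  \<comment> \<open>Among at least two colors, one of minimum price carries at most half of the
    total, so it can be sacrificed as the root.\<close>
  then obtain r where r: "r \<in> U" and r_min: "\<And>u. u \<in> U \<Longrightarrow> P r \<le> P u"
    using arg_min_if_finite[OF U(3), of P] by (meson not_le)
  have "r < C" using r U by auto
  have "2 * P r \<le> int M"
  proof (cases "P r \<le> 0")
    case False
    have "2 * P r \<le> int (card U) * P r" using U(2) False by (intro mult_right_mono) auto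
    also have "\<dots> \<le> int M" using sum_bounded_below[of U "P r" P] r_min sumP by simp
    finally show ?thesis .
  qed simp
  text \<open>The roundtrip from the root also has to pay for a single color. At most one color has a
    price above its roundtrip, and then the price of the root is negative enough to compensate.\<close>
  define trip where "trip v = int (d r v + d v r)" for v
  define q where "q v = nat (min (P v) (trip v))" for v
  have pair: "P u + P v \<le> int (d u v + d v u)" if "u \<in> U" "v \<in> U" "u \<noteq> v" for u v
    using P_le[of "[u, v]"] that by simp
  have half: "int M \<le> 2 * (\<Sum>v\<in>U - {r}. int (q v))"
  proof -
    have "int M - max 0 (P r) \<le> (\<Sum>v\<in>U - {r}. min (P v) (trip v))"
    proof (cases "\<exists>z\<in>U - {r}. trip z < P z")
      case False
      then have "min (P v) (trip v) = P v" if "v \<in> U - {r}" for v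
        using that by (meson min_absorb1 not_le)
      then have "(\<Sum>v\<in>U - {r}. min (P v) (trip v)) = (\<Sum>v\<in>U - {r}. P v)"
        by (rule sum.cong[OF refl])
      then show ?thesis using sumP sum.remove[OF U(3) r, of P] by simp
    next
      case True
      then obtain z where z: "z \<in> U" "z \<noteq> r" "trip z < P z" by auto
      have "min (P v) (trip v) = P v" if v: "v \<in> U - {r} - {z}" for v
      proof -
        \<comment> \<open>Going via the root shows \<open>P v + P z \<le> trip v + trip z\<close>.
          As \<open>z\<close> exceeds its roundtrip, \<open>v\<close> stays below its own.\<close>
        have "d v z \<le> d v r + d r z" "d z v \<le> d z r + d r v"
          using v z U \<open>r < C\<close> by (auto intro!: tri)
        then have "P v \<le> trip v" using pair[of v z] v z by (auto simp: trip_def)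
        then show ?thesis by simp
      qed
      then have "(\<Sum>v\<in>U - {r} - {z}. min (P v) (trip v)) = (\<Sum>v\<in>U - {r} - {z}. P v)"
        by (rule sum.cong[OF refl])
      then have "(\<Sum>v\<in>U - {r}. min (P v) (trip v)) = trip z + (\<Sum>v\<in>U - {r} - {z}. P v)"
        using sum.remove[of "U - {r}" z "\<lambda>v. min (P v) (trip v)"] U(3) z by simp
      moreover have "int M = P r + (P z + (\<Sum>v\<in>U - {r} - {z}. P v))"
        using sumP sum.remove[OF U(3) r, of P] sum.remove[of "U - {r}" z P] U(3) z by simp
      moreover have "P r + P z \<le> trip z" using pair[of r z] r z by (simp add: trip_def)
      ultimately show ?thesis by linarith
    qed
    also have "\<dots> \<le> (\<Sum>v\<in>U - {r}. int (q v))" by (intro sum_mono) (auto simp: q_def)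
    finally show ?thesis using \<open>2 * P r \<le> int M\<close> by linarith
  qed
  \<comment> \<open>Every color kept must receive at least one packet; colors of truncated price 0
    are dropped without changing the total.\<close>
  define Z where "Z = {v \<in> U - {r}. 1 \<le> q v}"
  have Z: "Z \<subseteq> U - {r}" "finite Z" using U(3) by (auto simp: Z_def)
  have "(\<Sum>v\<in>U - {r}. q v) = (\<Sum>v\<in>Z. q v)"
    using U(3) by (intro sum.mono_neutral_right) (auto simp: Z_def)
  then have MZ: "M \<le> 2 * (\<Sum>v\<in>Z. q v)" using half by (simp flip: of_nat_sum)
  then have Zne: "Z \<noteq> {}" using M1 by auto
  \<comment> \<open>Dual prices bound cycles that avoid the root, and rerouting the closing edge
    through the root only adds weight. A single color is no such cycle; for it the truncation by
    \<open>trip\<close> suffices.\<close>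
  have q_tour: "(\<Sum>v\<in>set vs. q v) \<le> rooted_tour d r vs"
    if vs: "distinct vs" "vs \<noteq> []" "set vs \<subseteq> Z" for vs
  proof (cases "length vs = 1")
    case True
    then obtain v where v: "vs = [v]" by (auto simp: length_Suc_conv)
    then show ?thesis by (simp add: rooted_tour_def q_def trip_def)
  next
    case False
    then have len: "2 \<le> length vs" using vs(2) by (cases vs) (auto simp: Suc_le_eq)
    have "int (\<Sum>v\<in>set vs. q v) \<le> (\<Sum>v\<in>set vs. P v)"
      unfolding of_nat_sum using vs(3) by (intro sum_mono) (auto simp: Z_def q_def)
    also have "\<dots> \<le> int (walk_weight d (vs @ [hd vs]))"
      using vs Z by (intro P_le[OF vs(1) _ len]) auto
    also have "walk_weight d (vs @ [hd vs]) \<le> rooted_tour d r vs"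
    proof -
      obtain us x where usx: "vs = us @ [x]" using vs(2) rev_exhaust by blast
      define y where "y = hd vs"
      have "x \<in> set vs" "y \<in> set vs" using usx hd_in_set[OF vs(2)] by (auto simp: y_def)
      then have mem: "x < C" "y < C" using vs(3) Z U by auto
      have "walk_weight d (vs @ [y]) = walk_weight d vs + d x y"
        using walk_weight_append[of d us x "[y]"] by (simp add: usx)
      also have "\<dots> \<le> walk_weight d vs + (d x r + d r y)"
        using tri[OF mem \<open>r < C\<close>] by simp
      also have "\<dots> = rooted_tour d r vs"
      proof -
        have "rooted_tour d r vs = d r y + walk_weight d (vs @ [r])"
          using vs(2) by (simp add: rooted_tour_def walk_weight_Cons y_def)
        also have "walk_weight d (vs @ [r]) = walk_weight d vs + d x r"
          using walk_weight_append[of d us x "[r]"] by (simp add: usx)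
        finally show ?thesis by simp
      qed
      finally show ?thesis by (simp add: y_def)
    qed
    finally show ?thesis by (simp only: of_nat_le_iff)
  qed
  define tours where "tours S = {vs. distinct vs \<and> set vs = S}" for S :: "nat set"
  define cost where "cost S = Min (rooted_tour d r ` tours S)" for S
  have fin_tours: "finite (tours S)" if "finite S" for S
    by (rule finite_subset[OF _ finite_lists_length_eq[OF that, of "card S"]])
      (auto simp: tours_def distinct_card)
  have cost_le: "cost (set vs) \<le> rooted_tour d r vs" if "distinct vs" for vs
    unfolding cost_def using that fin_tours by (intro Min_le) (auto simp: tours_def)
  have cost_attained: "\<exists>vs. distinct vs \<and> set vs = S \<and> rooted_tour d r vs = cost S" if "finite S" for S
  proof -
    have "tours S \<noteq> {}" using finite_distinct_list[OF that] by (auto simp: tours_def)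
    then have "cost S \<in> rooted_tour d r ` tours S"
      unfolding cost_def using fin_tours[OF that] by (intro Min_in) auto
    then show ?thesis by (auto simp: tours_def)
  qed
  have finS: "finite S" if "S \<subseteq> Z" for S using that Z(2) finite_subset by blast
  have tri': "\<And>x y z. \<lbrakk>x \<in> {..<C}; y \<in> {..<C}; z \<in> {..<C}\<rbrakk> \<Longrightarrow> d x z \<le> d x y + d y z"
    using tri by auto
  obtain V a where V: "V \<subseteq> Z" "V \<noteq> {}" "1 \<le> a"
    "real (\<Sum>v\<in>Z. q v) \<le> 2 * (a * real (\<Sum>v\<in>V. q v))"
    "real (cost V) \<le> 2 * a * real (\<Sum>v\<in>V. q v)"
    "\<And>S. \<lbrakk>S \<subseteq> V; S \<noteq> {}\<rbrakk> \<Longrightarrow> a * real (\<Sum>v\<in>S. q v) \<le> real (cost S)"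
  proof (rule uniformly_expensive_subset[OF Z(2) Zne, of "\<lambda>S. real (\<Sum>v\<in>S. q v)" "\<lambda>S. real (cost S)"])
    fix S assume S: "S \<subseteq> Z" "S \<noteq> {}"
    have "0 < (\<Sum>v\<in>S. q v)" using S finS by (intro sum_pos) (auto simp: Z_def)
    then show "0 < real (\<Sum>v\<in>S. q v)" by (simp only: of_nat_0_less_iff)
    obtain vs where "distinct vs" "set vs = S" "rooted_tour d r vs = cost S"
      using cost_attained[OF finS[OF S(1)]] by blast
    then show "real (\<Sum>v\<in>S. q v) \<le> real (cost S)"
      using q_tour[of vs] S by (auto simp flip: of_nat_sum)
  next
    fix S S' assume S: "S \<subseteq> Z" "S' \<subseteq> Z" "S \<inter> S' = {}"
    then show "real (\<Sum>v\<in>S \<union> S'. q v) = real (\<Sum>v\<in>S. q v) + real (\<Sum>v\<in>S'. q v)"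
      using finS by (simp add: sum.union_disjoint)
    obtain us vs where us: "distinct us" "set us = S" "rooted_tour d r us = cost S"
      and vs: "distinct vs" "set vs = S'" "rooted_tour d r vs = cost S'"
      using cost_attained[OF finS[OF S(1)]] cost_attained[OF finS[OF S(2)]] by metis
    have "cost (S \<union> S') \<le> rooted_tour d r (us @ vs)"
      using cost_le[of "us @ vs"] us vs S(3) by simp
    also have "\<dots> \<le> rooted_tour d r us + rooted_tour d r vs"
    proof (rule rooted_tour_append)
      show "insert r (set us \<union> set vs) \<subseteq> {..<C}" using us vs S Z U \<open>r < C\<close> by auto
    qed (rule tri')
    finally have "cost (S \<union> S') \<le> cost S + cost S'" using us vs by simp
    then show "real (cost (S \<union> S')) \<le> real (cost S) + real (cost S')"
      by (simp only: of_nat_le_iff flip: of_nat_add)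
  qed (rule that; (assumption | blast))
  obtain vs where vs: "distinct vs" "set vs = V" "rooted_tour d r vs = cost V"
    using cost_attained[OF finS[OF V(1)]] by blast
  have VU: "V \<subseteq> {..<C} - {r}" using V(1) Z U by auto
  show thesis
  proof (rule that[OF \<open>r < C\<close> vs(1)])
    show "vs \<noteq> []" "set vs \<subseteq> {..<C} - {r}" "1 \<le> a" using vs V VU by auto
    show "1 \<le> q v" if "v \<in> set vs" for v using that vs V by (auto simp: Z_def)
    show "real (rooted_tour d r vs) \<le> 2 * (a * real (\<Sum>v\<in>set vs. q v))"
      using vs V by (simp add: mult.assoc)
    have "real M \<le> 2 * real (\<Sum>v\<in>Z. q v)" using MZ by linarith
    also have "\<dots> \<le> 4 * (a * real (\<Sum>v\<in>V. q v))" using V(4) by linarith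
    finally have "real k * real M \<le> real k * (4 * (a * real (\<Sum>v\<in>V. q v)))"
      by (intro mult_left_mono of_nat_0_le_iff)
    then show "T \<le> 4 * real k * (a * real (\<Sum>v\<in>set vs. q v))"
      using TM vs(2) by (simp add: mult_ac)
    fix ys assume ys: "set ys \<subseteq> insert r (set vs)"
    show "a * real (\<Sum>v\<in>set ys - {r}. q v) \<le> real (rooted_tour d r ys)"
    proof (cases "set ys - {r} = {}")
      case False
      have sub: "insert r (set ys) \<subseteq> {..<C}" using ys vs VU \<open>r < C\<close> by auto
      obtain us where us: "distinct us" "set us = set ys - {r}" "rooted_tour d r us \<le> rooted_tour d r ys"
        by (rule rooted_tour_simple[OF sub, of d], erule (2) tri', rule that)
      have "a * real (\<Sum>v\<in>set ys - {r}. q v) \<le> real (cost (set ys - {r}))"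
        using ys vs False by (intro V(6)) auto
      also have "\<dots> \<le> real (rooted_tour d r us)" using cost_le[OF us(1)] us(2) by simp
      finally show ?thesis using us(3) by simp
    next
      case True
      then show ?thesis by (simp only: sum.empty of_nat_0 mult_zero_right of_nat_0_le_iff)
    qed
  qed
qed

section \<open>Schedules and walks\<close>

lemma throughput_le:
  assumes "feasible w \<sigma> S"
  shows "throughput S \<le> length \<sigma>"
proof -
  have "{i. \<exists>t. S t = Transmit i} \<subseteq> {..<length \<sigma>}"
    using assms by (auto simp: feasible_def)
  from card_mono[OF _ this] show ?thesis by (simp add: throughput_def)
qed

lemma throughput_le_OPT:
  assumes "feasible w \<sigma> S"
  shows "throughput S \<le> OPT w \<sigma>"
proof -
  have "{throughput S | S. feasible w \<sigma> S} \<subseteq> {..length \<sigma>}"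
    using throughput_le by auto
  then have "finite {throughput S | S. feasible w \<sigma> S}"
    by (rule finite_subset) simp
  then show ?thesis unfolding OPT_def using assms by (intro Max_ge) auto
qed

text \<open>Transmits the packets in the given order, each as early as possible, after the last
  transmission had color \<open>c\<close> and took place in slot \<open>t\<close>.\<close>

fun on_time :: "(nat \<Rightarrow> nat \<Rightarrow> nat) \<Rightarrow> nat \<Rightarrow> nat \<Rightarrow> packet list \<Rightarrow> bool" where
  "on_time d t c [] \<longleftrightarrow> True"
| "on_time d t c (p # ps) \<longleftrightarrow> Suc t + d c (color p) \<le> deadline p \<and>
     on_time d (Suc t + d c (color p)) (color p) ps"

lemma on_time_append:
  "on_time d t c (ps @ ps') \<longleftrightarrow> on_time d t c ps \<and>
    on_time d (t + length ps + walk_weight d (c # map color ps)) (last (c # map color ps)) ps'"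
  by (induction ps arbitrary: t c) (auto simp: add_ac)

lemma on_time_mono: "on_time d t c ps \<Longrightarrow> t' \<le> t \<Longrightarrow> on_time d t' c ps"
  by (induction ps arbitrary: t t' c) (auto intro: le_trans)

text \<open>Lets a return to color \<open>r\<close> that was already budgeted before time
  \<open>t\<close> be charged to the first packet of \<open>ps\<close>.\<close>

lemma on_time_switch:
  assumes "on_time d t r ps" "d r r = 0" "t' + d c r \<le> t" "ps \<noteq> [] \<Longrightarrow> color (hd ps) = r"
  shows "on_time d t' c ps"
proof (cases ps)
  case (Cons p ps')
  then have "on_time d (t' + d c r) r ps" using assms on_time_mono by blast
  then show ?thesis using Cons assms by simp
qed simp

lemma on_time_common_deadline:
  assumes "t + length ps + walk_weight d (c # map color ps) \<le> D" "\<And>p. p \<in> set ps \<Longrightarrow> D \<le> deadline p"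
  shows "on_time d t c ps"
  using assms
proof (induction ps arbitrary: t c)
  case (Cons p ps)
  have "on_time d (Suc t + d c (color p)) (color p) ps"
    using Cons.prems by (intro Cons.IH) (auto simp: add_ac)
  moreover have "D \<le> deadline p" using Cons.prems by simp
  ultimately show ?case using Cons.prems(1) by simp
qed simp

lemma on_time_nth:
  assumes "on_time d t c ps" "k < length ps"
  shows "t + Suc k + walk_weight d (c # map color (take (Suc k) ps)) \<le> deadline (ps ! k)"
  using assms
proof (induction ps arbitrary: t c k)
  case (Cons p ps)
  show ?case
  proof (cases k)
    case (Suc m)
    then have "Suc t + d c (color p) + Suc m + walk_weight d (color p # map color (take (Suc m) ps))
        \<le> deadline (ps ! m)"
      using Cons.prems by (intro Cons.IH) auto
    then show ?thesis using Suc by (simp add: add_ac)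
  qed (use Cons.prems in simp)
qed simp

text \<open>The packet at position \<open>k\<close> of the order is sent no earlier than slot
  \<open>k + 1\<close>, so the condition on releases can refer to positions instead of actual
  times.\<close>

lemma length_le_OPT:
  assumes qs: "distinct qs" "set qs \<subseteq> {..<length \<sigma>}"
    and on_time: "on_time d 0 c (map ((!) \<sigma>) qs)"
    and release: "\<And>k. k < length qs \<Longrightarrow> release (\<sigma> ! (qs ! k)) \<le> Suc k"
    and w_le: "\<And>i j. \<lbrakk>i \<in> set qs; j \<in> set qs\<rbrakk> \<Longrightarrow>
      w (color (\<sigma> ! i)) (color (\<sigma> ! j)) \<le> real (d (color (\<sigma> ! i)) (color (\<sigma> ! j)))"
  shows "length qs \<le> OPT w \<sigma>"
proof -
  define m where "m = length qs"
  define col where "col k = color (\<sigma> ! (qs ! k))" for k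
  define \<tau> where "\<tau> k = Suc k + walk_weight d (c # map col [0..<Suc k])" for k
  have colors: "map color (take k (map ((!) \<sigma>) qs)) = map col [0..<k]" if "k \<le> m" for k
    using that by (intro nth_equalityI) (auto simp: m_def col_def)
  have \<tau>_Suc: "\<tau> (Suc k) = \<tau> k + Suc (d (col k) (col (Suc k)))" for k
    using walk_weight_append[of d "c # map col [0..<k]" "col k" "[col (Suc k)]"]
    by (simp add: \<tau>_def)
  have \<tau>_mono: "strict_mono \<tau>" by (rule strict_mono_Suc_iff[THEN iffD2]) (simp add: \<tau>_Suc)
  have \<tau>_less: "\<tau> k < \<tau> l \<longleftrightarrow> k < l" and \<tau>_eq: "\<tau> k = \<tau> l \<longleftrightarrow> k = l" for k l
    using strict_mono_less[OF \<tau>_mono] strict_mono_eq[OF \<tau>_mono] by auto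
  \<comment> \<open>All slots without a packet count as transitions, so the gap between consecutive
    packets holds exactly \<open>d\<close> of them.\<close>
  define S where "S t = (if \<exists>k<m. \<tau> k = t then Transmit (qs ! (THE k. \<tau> k = t)) else Transition)" for t
  have S_iff: "S t = Transmit i \<longleftrightarrow> (\<exists>k<m. t = \<tau> k \<and> i = qs ! k)" for t i
    by (auto simp: S_def \<tau>_eq)
  have deadline: "\<tau> k \<le> deadline (\<sigma> ! (qs ! k))" if "k < m" for k
    using on_time_nth[OF on_time, of k] that colors[of "Suc k"] by (simp add: \<tau>_def m_def)
  have "feasible w \<sigma> S"
    unfolding feasible_def
  proof (intro conjI allI impI)
    fix t i assume "S t = Transmit i"
    then obtain k where k: "k < m" "t = \<tau> k" "i = qs ! k" by (auto simp: S_iff)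
    then have "i \<in> set qs" by (simp add: m_def)
    then show "i < length \<sigma>" using qs(2) by auto
    show "release (\<sigma> ! i) \<le> t" using release[of k] k by (simp add: m_def \<tau>_def)
    show "t \<le> deadline (\<sigma> ! i)" using deadline k by simp
  next
    fix s t i assume "S s = Transmit i" "S t = Transmit i"
    then show "s = t" using qs(1) by (auto simp: S_iff m_def nth_eq_iff_index_eq)
  next
    fix s t i j
    assume st: "s < t" "S s = Transmit i" "S t = Transmit j"
      and gap: "\<forall>u k. s < u \<longrightarrow> u < t \<longrightarrow> S u \<noteq> Transmit k"
    obtain k l where k: "k < m" "s = \<tau> k" "i = qs ! k" and l: "l < m" "t = \<tau> l" "j = qs ! l"
      using st by (auto simp: S_iff)
    have "l = Suc k"
    proof (rule ccontr)
      assume "l \<noteq> Suc k"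
      then have "Suc k < l" using st(1) k l by (simp add: \<tau>_less)
      moreover have "S (\<tau> (Suc k)) = Transmit (qs ! Suc k)"
        unfolding S_iff using \<open>Suc k < l\<close> l(1) less_trans by blast
      ultimately show False using gap k l by (auto simp: \<tau>_less)
    qed
    have "{u. s < u \<and> u < t \<and> S u = Transition} = {s<..<t}"
    proof -
      have "S u = Transition \<or> (\<exists>i. S u = Transmit i)" for u by (simp add: S_def)
      then have "S u = Transition" if "s < u" "u < t" for u using gap that by blast
      then show ?thesis by auto
    qed
    then have "card {u. s < u \<and> u < t \<and> S u = Transition} = d (col k) (col l)"
      using k l \<open>l = Suc k\<close> by (simp add: \<tau>_Suc)
    then show "w (color (\<sigma> ! i)) (color (\<sigma> ! j)) \<le>
        real (card {u. s < u \<and> u < t \<and> S u = Transition})"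
      using w_le[of i j] k l by (simp add: col_def m_def)
  qed
  then have "throughput S \<le> OPT w \<sigma>" by (rule throughput_le_OPT)
  moreover have "{i. \<exists>t. S t = Transmit i} = set qs"
    by (auto simp: S_iff m_def in_set_conv_nth)
  ultimately show ?thesis using distinct_card[OF qs(1)] by (simp add: throughput_def)
qed

text \<open>The converse direction: transition slots pay for a walk through precisely the colors
  served. Costs are rounded up since slots are whole, and the diagonal must be free since
  \<open>feasible\<close> demands nothing between equal colors. Length at least 2 lets a walk from
  the root to the root be read as a rooted tour.\<close>

lemma feasible_walk:
  assumes S: "feasible w \<sigma> S" and diag: "\<And>i. i < length \<sigma> \<Longrightarrow> w (color (\<sigma> ! i)) (color (\<sigma> ! i)) \<le> 0"
    and a: "S a = Transmit i" and "a \<le> b" "S b = Transmit j"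
  shows "\<exists>cs. cs \<noteq> [] \<and> hd cs = color (\<sigma> ! i) \<and> last cs = color (\<sigma> ! j) \<and>
    set cs = {color (\<sigma> ! k) | k u. a \<le> u \<and> u \<le> b \<and> S u = Transmit k} \<and> (a < b \<longrightarrow> 2 \<le> length cs) \<and>
    walk_weight (\<lambda>c c'. nat \<lceil>w c c'\<rceil>) cs \<le> card {u. a < u \<and> u < b \<and> S u = Transition}"
  using assms(4,5)
proof (induction b arbitrary: j rule: less_induct)
  case (less b)
  show ?case
  proof (cases "a = b")
    case True
    then show ?thesis using a less.prems by (intro exI[of _ "[color (\<sigma> ! i)]"]) auto
  next
    case False
    then have "a < b" using less.prems by simp
    define U where "U = {u. a \<le> u \<and> u < b \<and> (\<exists>k. S u = Transmit k)}"
    have "finite U" "a \<in> U" using a \<open>a < b\<close> by (auto simp: U_def)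
    define b' where "b' = Max U"
    have "b' \<in> U" unfolding b'_def using \<open>finite U\<close> \<open>a \<in> U\<close> by (intro Max_in) auto
    then obtain j' where b': "a \<le> b'" "b' < b" "S b' = Transmit j'" by (auto simp: U_def)
    have gap: "S u \<noteq> Transmit k" if "b' < u" "u < b" for u k
    proof
      assume "S u = Transmit k"
      then have "u \<in> U" using that b' by (auto simp: U_def)
      then have "u \<le> b'" unfolding b'_def using \<open>finite U\<close> by simp
      then show False using that by simp
    qed
    obtain cs where cs: "cs \<noteq> []" "hd cs = color (\<sigma> ! i)" "last cs = color (\<sigma> ! j')"
      "set cs = {color (\<sigma> ! k) | k u. a \<le> u \<and> u \<le> b' \<and> S u = Transmit k}"
      "walk_weight (\<lambda>c c'. nat \<lceil>w c c'\<rceil>) cs \<le> card {u. a < u \<and> u < b' \<and> S u = Transition}"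
      using less.IH[OF b'(2,1,3)] by (elim exE conjE)
    have "nat \<lceil>w (color (\<sigma> ! j')) (color (\<sigma> ! j))\<rceil> \<le> card {u. b' < u \<and> u < b \<and> S u = Transition}"
    proof (cases "color (\<sigma> ! j') = color (\<sigma> ! j)")
      case True
      have "j < length \<sigma>" using S less.prems(2) by (auto simp: feasible_def)
      then have "\<lceil>w (color (\<sigma> ! j')) (color (\<sigma> ! j))\<rceil> \<le> 0"
        using diag[of j] True by (simp add: ceiling_le_iff)
      then show ?thesis by simp
    next
      case False
      then have "w (color (\<sigma> ! j')) (color (\<sigma> ! j)) \<le> real (card {u. b' < u \<and> u < b \<and> S u = Transition})"
        using S b' less.prems(2) gap unfolding feasible_def by blast
      then have "\<lceil>w (color (\<sigma> ! j')) (color (\<sigma> ! j))\<rceil> \<le> int (card {u. b' < u \<and> u < b \<and> S u = Transition})"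
        by (simp only: ceiling_le_iff of_int_of_nat_eq)
      then show ?thesis by (simp only: nat_le_iff)
    qed
    moreover have "card {u. a < u \<and> u < b' \<and> S u = Transition} +
        card {u. b' < u \<and> u < b \<and> S u = Transition} \<le> card {u. a < u \<and> u < b \<and> S u = Transition}"
      using b' by (subst card_Un_disjoint[symmetric]) (auto intro!: card_mono)
    moreover obtain us where "cs = us @ [color (\<sigma> ! j')]"
      using cs(1,3) by (metis append_butlast_last_id)
    then have "walk_weight (\<lambda>c c'. nat \<lceil>w c c'\<rceil>) (cs @ [color (\<sigma> ! j)]) =
        walk_weight (\<lambda>c c'. nat \<lceil>w c c'\<rceil>) cs + nat \<lceil>w (color (\<sigma> ! j')) (color (\<sigma> ! j))\<rceil>"
      using walk_weight_append[of "\<lambda>c c'. nat \<lceil>w c c'\<rceil>" us "color (\<sigma> ! j')" "[color (\<sigma> ! j)]"]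
      by simp
    ultimately have "walk_weight (\<lambda>c c'. nat \<lceil>w c c'\<rceil>) (cs @ [color (\<sigma> ! j)])
        \<le> card {u. a < u \<and> u < b \<and> S u = Transition}"
      using cs(5) by linarith
    moreover have "set (cs @ [color (\<sigma> ! j)]) =
        {color (\<sigma> ! k) | k u. a \<le> u \<and> u \<le> b \<and> S u = Transmit k}"
    proof (intro equalityI subsetI)
      fix c assume "c \<in> set (cs @ [color (\<sigma> ! j)])"
      then consider "c \<in> set cs" | "c = color (\<sigma> ! j)" by auto
      then show "c \<in> {color (\<sigma> ! k) | k u. a \<le> u \<and> u \<le> b \<and> S u = Transmit k}"
      proof cases
        case 1
        then obtain k u where "c = color (\<sigma> ! k)" "a \<le> u" "u \<le> b'" "S u = Transmit k"
          unfolding cs(4) by blast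
        moreover from this have "u \<le> b" using b'(2) by simp
        ultimately show ?thesis by blast
      next
        case 2
        then show ?thesis using less.prems by blast
      qed
    next
      fix c assume "c \<in> {color (\<sigma> ! k) | k u. a \<le> u \<and> u \<le> b \<and> S u = Transmit k}"
      then obtain k u where u: "c = color (\<sigma> ! k)" "a \<le> u" "u \<le> b" "S u = Transmit k" by blast
      show "c \<in> set (cs @ [color (\<sigma> ! j)])"
      proof (cases "u \<le> b'")
        case True
        then have "c \<in> set cs" unfolding cs(4) using u by blast
        then show ?thesis by simp
      next
        case False
        then have "u = b" using gap[of u k] u by force
        then show ?thesis using u less.prems(2) by simp
      qed
    qed
    ultimately show ?thesis
      using cs(1,2) by (intro exI[of _ "cs @ [color (\<sigma> ! j)]"]) (auto simp: Suc_le_eq)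
  qed
qed

section \<open>The hard input\<close>

lemma nth_concat_equal_length:
  assumes "\<And>j. j < J \<Longrightarrow> length (f j) = m" "j < J" "k < m"
  shows "concat (map f [0..<J]) ! (m * j + k) = f j ! k"
  using assms
proof (induction J)
  case (Suc J)
  have len: "length (concat (map f [0..<i])) = m * i" if "i \<le> J" for i
    using that Suc.prems(1) by (induction i) auto
  show ?case
  proof (cases "j = J")
    case True
    then show ?thesis using len[of J] Suc.prems by (simp add: nth_append)
  next
    case False
    then have "j < J" using Suc.prems by simp
    have "m * j + k < m * Suc j" using Suc.prems(3) by simp
    also have "\<dots> \<le> m * J" using \<open>j < J\<close> by (intro mult_le_mono2) simp
    finally show ?thesis
      using Suc.IH Suc.prems \<open>j < J\<close> len[of J] by (simp add: nth_append)
  qed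
qed simp

locale hard_input =
  fixes w :: "nat \<Rightarrow> nat \<Rightarrow> real" and C r L n J :: nat and vs :: "nat list" and q :: "nat \<Rightarrow> nat"
  assumes costs: "transition_costs C w"
    and L: "1 \<le> L" and n: "1 \<le> n"
    and r: "r < C" and vs: "distinct vs" "vs \<noteq> []" "set vs \<subseteq> {..<C} - {r}"
    and q: "\<And>v. v \<in> set vs \<Longrightarrow> 1 \<le> q v"
begin

text \<open>
  Period \<open>j < J\<close> consists of the slots after \<open>tt j\<close> up to \<open>tt (Suc j)\<close>. The fillers are what the
  optimum transmits after the last period if no flood arrives; if it does, they replace the
  other colors during the periods. The bulk has laxity exactly \<open>L\<close> and keeps all schedules
  from working ahead before the first period.
\<close>

definition d :: "nat \<Rightarrow> nat \<Rightarrow> nat" where "d j k = nat \<lceil>w j k\<rceil>"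
definition vlist :: "nat list" where "vlist = concat (map (\<lambda>v. replicate (n * q v) v) vs)"
definition Q :: nat where "Q = (\<Sum>v\<in>set vs. q v)"
definition K :: nat where "K = n * Q"
definition W :: nat where "W = rooted_tour d r vs"
definition tt :: "nat \<Rightarrow> nat" where "tt j = Suc L + j * (2 * K + W)"
definition F :: nat where "F = J * (K + W)"
definition E :: nat where "E = tt J + (Suc L + F)"
definition batch :: "nat \<Rightarrow> packet list" where
  "batch j = map (Packet 1 (tt (Suc j))) (replicate K r @ vlist)"
definition bulk :: "packet list" where "bulk = replicate (Suc L) (Packet 1 (tt 0) r)"
definition filler :: "packet list" where "filler = replicate F (Packet 1 E r)"
definition flood :: "packet list" where "flood = replicate (Suc L + F) (Packet (Suc (tt J)) E r)"
definition calm :: "packet list" where "calm = bulk @ concat (map batch [0..<J]) @ filler"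

lemma d_diag [simp]: "j < C \<Longrightarrow> d j j = 0"
  using costs by (simp add: d_def transition_costs_def)

lemma w_le_d: "w j k \<le> real (d j k)"
  unfolding d_def by linarith

lemma vs_less: "v \<in> set vs \<Longrightarrow> v < C" and vs_ne_r: "v \<in> set vs \<Longrightarrow> v \<noteq> r"
  using vs by auto

lemma set_vlist: "set vlist = set vs"
  using n q by (fastforce simp: vlist_def Suc_le_eq)

lemma length_vlist: "length vlist = K"
proof -
  have "length vlist = (\<Sum>v\<leftarrow>vs. n * q v)"
    by (simp add: vlist_def length_concat o_def)
  also have "\<dots> = (\<Sum>v\<in>set vs. n * q v)"
    by (rule sum_list_distinct_conv_sum_set[OF vs(1)])
  finally show ?thesis by (simp add: K_def Q_def sum_distrib_left)
qed

lemma K_pos: "0 < K"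
proof -
  have "vlist \<noteq> []" using set_vlist vs by auto
  then show ?thesis using length_vlist by (metis length_greater_0_conv)
qed

lemma walk_weight_replicate:
  assumes "0 < m" "d v v = 0"
  shows "walk_weight d (c # replicate m v @ xs) = d c v + walk_weight d (v # xs)"
  using assms
proof (induction m arbitrary: c)
  case (Suc m)
  then show ?case by (cases m) auto
qed simp

lemma walk_weight_vlist: "walk_weight d (r # vlist @ [r]) = W"
proof -
  have "walk_weight d (c # concat (map (\<lambda>v. replicate (n * q v) v) us) @ [r]) =
      walk_weight d (c # us @ [r])" if "set us \<subseteq> set vs" for us c
    using that
  proof (induction us arbitrary: c)
    case (Cons u us)
    then have "0 < n * q u" "d u u = 0" using n q[of u] vs_less by auto
    then show ?case using Cons by (simp add: walk_weight_replicate)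
  qed simp
  then show ?thesis by (simp add: vlist_def W_def rooted_tour_def)
qed

lemma walk_weight_r: "walk_weight d (r # replicate m r @ xs) = walk_weight d (r # xs)"
  using r by (cases "m = 0") (simp_all add: walk_weight_replicate)

lemma length_batch: "length (batch j) = 2 * K"
  by (simp add: batch_def length_vlist)

lemma length_batches: "length (concat (map batch [0..<i])) = 2 * K * i"
  by (induction i) (simp_all add: length_batch)

lemma release_calm: "p \<in> set calm \<Longrightarrow> release p = 1"
  by (auto simp: calm_def bulk_def filler_def batch_def)

lemma color_calm: "p \<in> set calm \<Longrightarrow> color p \<in> insert r (set vs)"
  by (auto simp: calm_def bulk_def filler_def batch_def set_vlist)

lemma length_calm: "length calm = Suc L + 2 * K * J + F"
  by (simp add: calm_def bulk_def filler_def length_batches)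

lemma nth_batch:
  assumes "j < J" "k < 2 * K"
  shows "calm ! (Suc L + 2 * K * j + k) = batch j ! k"
proof -
  have "2 * K * j + k < 2 * K * Suc j" using assms by simp
  also have "\<dots> \<le> 2 * K * J" using assms by (intro mult_le_mono2) simp
  finally have "2 * K * j + k < length (concat (map batch [0..<J]))"
    by (simp add: length_batches)
  then show ?thesis
    using nth_concat_equal_length[of J batch "2 * K" j k] assms
    by (simp add: calm_def bulk_def nth_append length_batch add.assoc del: replicate_Suc)
qed

text \<open>Bulk and batches appear in order of deadline, and division by \<open>2 * K\<close>
  recovers the batch to which a position belongs.\<close>

lemma deadline_early:
  assumes "j \<le> J" "i < Suc L + 2 * K * j"
  shows "deadline (calm ! i) \<le> tt j"
proof (cases "i < Suc L")
  case True
  then have "calm ! i = Packet 1 (tt 0) r"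
    by (simp add: calm_def bulk_def nth_append del: replicate_Suc)
  then show ?thesis by (simp add: tt_def)
next
  case False
  define l where "l = (i - Suc L) div (2 * K)"
  define k where "k = (i - Suc L) mod (2 * K)"
  have i: "i = Suc L + 2 * K * l + k" using False by (simp add: l_def k_def)
  have k: "k < 2 * K" using K_pos by (simp add: k_def)
  have "2 * K * l < 2 * K * j" using assms(2) i by linarith
  then have "l < j" by simp
  then have "calm ! i = batch l ! k" using nth_batch[of l k] assms(1) k i by simp
  moreover have "deadline (batch l ! k) = tt (Suc l)"
    using k by (simp add: batch_def length_vlist del: map_append)
  moreover have "tt (Suc l) \<le> tt j"
    using mult_le_mono1[of "Suc l" j "2 * K + W"] \<open>l < j\<close> by (simp add: tt_def)
  ultimately show ?thesis by simp
qed

section \<open>Optimal throughput with and without the flood\<close>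

lemma E_eq: "E = Suc L + J * K + F + (Suc L + F)"
  by (simp add: E_def tt_def F_def algebra_simps)

lemma real_E: "real E = 2 * real L + 2 + real J * (3 * real K + 2 * real W)"
  by (simp add: E_def tt_def F_def algebra_simps)

text \<open>The identity behind the choice of \<open>F\<close>: bulk, root halves of the batches and
  fillers are just enough root packets to occupy every slot through \<open>tt J\<close>.\<close>

lemma tt_J_eq: "tt J = Suc L + J * K + F"
  by (simp add: tt_def F_def algebra_simps)

lemma length_calm_le_E: "length calm \<le> E"
  by (simp add: length_calm E_def tt_def F_def algebra_simps)

lemma tt_le_E:
  assumes "j \<le> J"
  shows "tt j \<le> E"
  unfolding E_def tt_def using mult_le_mono1[OF assms, of "2 * K + W"] by linarith

text \<open>A period has exactly the \<open>2 * K + W\<close> slots that its batch and one roundtrip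
  consume, so every period can begin at the root. The induction runs backwards because
  \<open>on_time\<close> of a list depends on its tail.\<close>

lemma on_time_batches:
  assumes "i \<le> J"
  shows "on_time d (tt (J - i)) r (concat (map batch [J - i..<J]) @ filler)"
  using assms
proof (induction i)
  case 0
  have "on_time d (tt J) r filler"
    using r by (intro on_time_common_deadline[where D = E])
      (auto simp: filler_def E_def map_replicate_const walk_weight_r[of _ "[]", simplified])
  then show ?case by simp
next
  case (Suc i)
  define j where "j = J - Suc i"
  have j: "Suc j = J - i" "j < J" using Suc.prems by (auto simp: j_def)
  define rest where "rest = concat (map batch [Suc j..<J]) @ filler"
  have IH: "on_time d (tt (Suc j)) r rest" using Suc j by (simp add: rest_def)
  have rest_r: "color (hd rest) = r" if "rest \<noteq> []"
  proof (cases "Suc j < J")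
    case True
    then show ?thesis
      using K_pos by (cases K) (simp_all add: rest_def upt_conv_Cons batch_def)
  next
    case False
    then show ?thesis using that by (cases F) (auto simp: rest_def filler_def)
  qed
  define c where "c = last (r # map color (batch j))"
  have colors: "map color (batch j) = replicate K r @ vlist"
    by (simp add: batch_def o_def)
  \<comment> \<open>\<open>W\<close> includes the return to the root, which \<open>on_time\<close>
    charges only to the next packet; \<open>c\<close> is the color where that return begins.\<close>
  have W_eq: "walk_weight d (r # map color (batch j)) + d c r = W"
  proof -
    obtain us where us: "r # map color (batch j) = us @ [c]"
      unfolding c_def by (metis append_butlast_last_id list.distinct(1))
    have "W = walk_weight d (r # replicate K r @ vlist @ [r])"
      by (simp add: walk_weight_r walk_weight_vlist)
    also have "r # replicate K r @ vlist @ [r] = us @ c # [r]"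
      using us colors by simp
    finally show ?thesis using us by (simp add: walk_weight_append[of d us c "[r]"])
  qed
  have tt_Suc: "tt (Suc j) = tt j + 2 * K + W" by (simp add: tt_def)
  have "on_time d (tt j) r (batch j)"
  proof (rule on_time_common_deadline[where D = "tt (Suc j)"])
    show "tt j + length (batch j) + walk_weight d (r # map color (batch j)) \<le> tt (Suc j)"
      using W_eq by (simp add: length_batch tt_Suc)
  qed (auto simp: batch_def)
  moreover have "on_time d (tt j + length (batch j) + walk_weight d (r # map color (batch j))) c rest"
    using W_eq r rest_r by (intro on_time_switch[OF IH]) (auto simp: length_batch tt_Suc)
  moreover have "concat (map batch [j..<J]) @ filler = batch j @ rest"
    using j by (simp add: rest_def upt_conv_Cons)
  ultimately show ?case by (simp add: on_time_append c_def flip: j_def)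
qed

text \<open>The packets are listed in an order in which all of them can be sent on time, so the
  schedule is the input itself.\<close>

lemma OPT_calm: "length calm \<le> OPT w calm"
proof -
  have "on_time d 0 r bulk"
    using walk_weight_r[of "Suc L" "[]"] by (intro on_time_common_deadline[where D = "tt 0"])
      (auto simp: bulk_def map_replicate_const tt_def simp del: replicate_Suc)
  moreover have "on_time d (0 + length bulk + walk_weight d (r # map color bulk))
      (last (r # map color bulk)) (concat (map batch [0..<J]) @ filler)"
    using on_time_batches[of J] walk_weight_r[of "Suc L" "[]"]
    by (simp add: bulk_def map_replicate_const tt_def last_replicate del: replicate_Suc)
  ultimately have "on_time d 0 r calm" by (simp add: calm_def on_time_append)
  then have "on_time d 0 r (map ((!) calm) [0..<length calm])" by (simp add: map_nth)
  then have "length [0..<length calm] \<le> OPT w calm"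
    using w_le_d release_calm
    by (intro length_le_OPT[where d = d and c = r]) auto
  then show ?thesis by simp
qed

text \<open>Sending root packets only avoids all transitions, and there are exactly \<open>E\<close>
  of them, one for each slot. Positions \<open>qs\<close> are carried along because schedules refer
  to packets by position.\<close>

lemma OPT_flood: "E \<le> OPT w (calm @ flood)"
proof -
  define rs where "rs = filter (\<lambda>p. color p = r) (calm @ flood)"
  define qs where "qs = filter (\<lambda>i. color ((calm @ flood) ! i) = r) [0..<length (calm @ flood)]"
  have qs_rs: "map ((!) (calm @ flood)) qs = rs"
  proof -
    have "rs = filter (\<lambda>p. color p = r) (map ((!) (calm @ flood)) [0..<length (calm @ flood)])"
      unfolding rs_def map_nth ..
    then show ?thesis unfolding qs_def filter_map o_def by (rule sym)
  qed
  define bs where "bs i = concat (map (\<lambda>j. replicate K (Packet 1 (tt (Suc j)) r)) [0..<i])" for i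
  have batch_r: "filter (\<lambda>p. color p = r) (batch j) = replicate K (Packet 1 (tt (Suc j)) r)" for j
  proof -
    have "filter (\<lambda>v. v = r) vlist = []"
      using set_vlist vs_ne_r by (auto simp: filter_empty_conv)
    then show ?thesis by (simp add: batch_def filter_map o_def map_replicate_const)
  qed
  have "filter (\<lambda>p. color p = r) (concat (map batch [0..<i])) = bs i" for i
    by (induction i) (simp_all add: bs_def batch_r)
  then have rs_eq: "rs = (bulk @ bs J @ filler) @ flood"
    by (simp add: rs_def calm_def bulk_def filler_def flood_def del: replicate_Suc)
  have len_bs: "length (bs i) = i * K" for i by (induction i) (simp_all add: bs_def)
  have len1: "length (bulk @ bs J @ filler) = tt J"
  proof -
    have "length bulk = Suc L" "length filler = F" by (simp_all add: bulk_def filler_def)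
    then show ?thesis unfolding length_append len_bs tt_J_eq by linarith
  qed
  have len: "length rs = E" unfolding rs_eq length_append[of _ flood] len1 by (simp add: E_def flood_def)
  have zero: "walk_weight d (r # map color ps) = 0" "last (r # map color ps) = r"
    if "set (map color ps) \<subseteq> {r}" for ps
  proof -
    have "map color ps = replicate (length ps) r"
      using that by (intro replicate_eqI) auto
    then show "walk_weight d (r # map color ps) = 0" "last (r # map color ps) = r"
      using walk_weight_r[of "length ps" "[]"] by (simp_all add: last_replicate)
  qed
  have on_bs: "on_time d (Suc L) r (bs i)" for i
  proof (induction i)
    case (Suc i)
    have bs_color: "set (map color (bs i)) \<subseteq> {r}" by (auto simp: bs_def)
    have "on_time d (Suc L + i * K) r (replicate K (Packet 1 (tt (Suc i)) r))"
      using walk_weight_r[of K "[]"]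
      by (intro on_time_common_deadline[where D = "tt (Suc i)"])
        (auto simp: map_replicate_const tt_def algebra_simps)
    moreover have "bs (Suc i) = bs i @ replicate K (Packet 1 (tt (Suc i)) r)"
      by (simp add: bs_def)
    ultimately show ?case
      using Suc zero[OF bs_color] by (simp add: on_time_append len_bs del: map_replicate)
  qed (simp add: bs_def)
  have "on_time d 0 r bulk"
    using walk_weight_r[of "Suc L" "[]"] by (intro on_time_common_deadline[where D = "tt 0"])
      (auto simp: bulk_def map_replicate_const tt_def simp del: replicate_Suc)
  moreover have "on_time d (Suc L + J * K) r (filler @ flood)"
  proof (rule on_time_common_deadline[where D = E])
    have "set (map color (filler @ flood)) \<subseteq> {r}" by (auto simp: filler_def flood_def)
    from zero(1)[OF this]
    show "Suc L + J * K + length (filler @ flood) + walk_weight d (r # map color (filler @ flood)) \<le> E"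
      by (simp add: E_eq filler_def flood_def)
  qed (auto simp: filler_def flood_def)
  moreover have "set (map color bulk) \<subseteq> {r}" "set (map color (bs J)) \<subseteq> {r}"
    by (auto simp: bulk_def bs_def)
  note zero[OF this(1)] zero[OF this(2)]
  ultimately have "on_time d 0 r rs"
    unfolding rs_eq append_assoc using on_bs[of J]
    by (simp only: on_time_append) (simp add: len_bs bulk_def del: replicate_Suc map_replicate)
  \<comment> \<open>Positions count from 0 and slots from 1: the flood begins at position
    \<open>tt J\<close>, just where its release in slot \<open>tt J + 1\<close> permits.\<close>
  moreover have "release (rs ! k) \<le> Suc k" if "k < length rs" for k
  proof (cases "k < tt J")
    case True
    then have "rs ! k \<in> set (bulk @ bs J @ filler)"
      using len1 nth_mem[of k "bulk @ bs J @ filler"] by (simp only: rs_eq nth_append) simp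
    then show ?thesis by (auto simp: bulk_def bs_def filler_def)
  next
    case False
    then have "rs ! k \<in> set flood"
      using that len1 by (simp only: rs_eq nth_append length_append) simp
    then show ?thesis using False by (auto simp: flood_def)
  qed
  moreover have len_qs: "length qs = length rs" using qs_rs by (metis length_map)
  moreover have "(calm @ flood) ! (qs ! k) = rs ! k" if "k < length qs" for k
    using that qs_rs by (metis nth_map)
  moreover have dist: "distinct qs" and in_qs: "\<And>i. i \<in> set qs \<Longrightarrow> i < length (calm @ flood)"
    by (auto simp: qs_def)
  ultimately have "length qs \<le> OPT w (calm @ flood)"
    using w_le_d by (intro length_le_OPT[where d = d and c = r]) (auto simp: qs_rs in_qs dist)
  then show ?thesis using len len_qs by simp
qed

text \<open>The deadlines are tight: a schedule that misses few deadlines is never far ahead of them,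
  so in every period it has to serve a large part of both halves of the current batch.\<close>

lemma batch_served:
  assumes S: "feasible w calm S" and slack: "4 * (J * W) \<le> K"
    and few: "8 * card {i. i < Suc L + 2 * K * J \<and> (\<forall>t. S t \<noteq> Transmit i)} < K"
    and j: "j < J" and B: "B \<subseteq> {Suc L + 2 * K * j..<Suc L + 2 * K * Suc j}" "card B = K"
  shows "K \<le> 2 * card {i \<in> B. \<exists>t. tt j < t \<and> t \<le> tt (Suc j) \<and> S t = Transmit i}"
proof -
  define N where "N j = Suc L + 2 * K * j" for j
  define miss where "miss = {i. i < N J \<and> (\<forall>t. S t \<noteq> Transmit i)}"
  define early where "early j = {i. \<exists>t\<le>tt j. S t = Transmit i}" for j
  define new where "new = {i \<in> B. \<exists>t. tt j < t \<and> t \<le> tt (Suc j) \<and> S t = Transmit i}"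
  have slot: "i < length calm" "1 \<le> t" "t \<le> deadline (calm ! i)" if "S t = Transmit i" for t i
  proof -
    have *: "i < length calm" "release (calm ! i) \<le> t" "t \<le> deadline (calm ! i)"
      using S that unfolding feasible_def by blast+
    then show "i < length calm" "t \<le> deadline (calm ! i)" by blast+
    show "1 \<le> t" using *(2) release_calm[OF nth_mem[OF *(1)]] by simp
  qed
  have finite_early: "finite (early l)" for l
  proof (rule finite_subset)
    show "early l \<subseteq> {..<length calm}" unfolding early_def using slot(1) by blast
  qed simp
  have card_early: "card (early l) \<le> tt l" for l
  proof -
    have "early l \<subseteq> (\<lambda>t. case S t of Transmit i \<Rightarrow> i | _ \<Rightarrow> 0) ` {1..tt l}"
    proof
      fix i assume "i \<in> early l"
      then obtain t where t: "t \<le> tt l" "S t = Transmit i" by (auto simp: early_def)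
      then show "i \<in> (\<lambda>t. case S t of Transmit i \<Rightarrow> i | _ \<Rightarrow> 0) ` {1..tt l}"
        using slot(2)[OF t(2)] by (intro image_eqI[of _ _ t]) auto
    qed
    then have "card (early l) \<le> card {1..tt l}" by (rule surj_card_le[rotated]) simp
    then show ?thesis by simp
  qed
  have N_mono: "N l \<le> N l'" if "l \<le> l'" for l l' using that by (simp add: N_def)
  have covered: "{..<N l} \<subseteq> early l \<union> miss" if "l \<le> J" for l
  proof
    fix i assume i: "i \<in> {..<N l}"
    then have "i < N J" using N_mono[OF that] by simp
    moreover have "t \<le> tt l" if "S t = Transmit i" for t
      using slot(3)[OF that] deadline_early[OF \<open>l \<le> J\<close>, of i] i by (simp add: N_def)
    ultimately show "i \<in> early l \<union> miss" by (auto simp: early_def miss_def)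
  qed
  have finite_miss: "finite miss" by (simp add: miss_def)
  \<comment> \<open>The \<open>tt j\<close> slots so far exceed the \<open>N j\<close> packets due
    by then by \<open>j * W\<close>. Each such packet takes a slot unless it is missed, and what
    remains bounds the work done ahead.\<close>
  have ahead: "card (early j - {..<N j}) \<le> j * W + card miss"
  proof -
    have "N j \<le> card ((early j \<inter> {..<N j}) \<union> miss)"
      using covered[of j] j card_mono[of "(early j \<inter> {..<N j}) \<union> miss" "{..<N j}"]
        finite_miss finite_early by auto
    also have "\<dots> \<le> card (early j \<inter> {..<N j}) + card miss" by (rule card_Un_le)
    finally have "N j \<le> card (early j \<inter> {..<N j}) + card miss" .
    moreover have "card (early j) = card (early j \<inter> {..<N j}) + card (early j - {..<N j})"
      using card_Int_Diff[OF finite_early] by simp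
    moreover have "tt j = N j + j * W" by (simp add: tt_def N_def algebra_simps)
    ultimately show ?thesis using card_early[of j] by linarith
  qed
  have "B \<subseteq> new \<union> (early j - {..<N j}) \<union> miss"
  proof
    fix i assume i: "i \<in> B"
    then have "N j \<le> i" "i < N (Suc j)" using B(1) by (auto simp: N_def)
    then have "i \<in> early (Suc j) \<union> miss" using covered[of "Suc j"] j by auto
    then consider "i \<in> miss" | t where "t \<le> tt (Suc j)" "S t = Transmit i"
      by (auto simp: early_def)
    then show "i \<in> new \<union> (early j - {..<N j}) \<union> miss"
    proof cases
      case (2 t)
      show ?thesis
      proof (cases "t \<le> tt j")
        case True
        then have "i \<in> early j" using 2 by (auto simp: early_def)
        then show ?thesis using \<open>N j \<le> i\<close> by simp
      next
        case False
        then have "i \<in> new" using 2 i by (auto simp: new_def not_le)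
        then show ?thesis by simp
      qed
    qed simp
  qed
  moreover have "finite new"
    using B(2) K_pos card_gt_0_iff[of B] by (simp add: new_def)
  ultimately have "card B \<le> card (new \<union> (early j - {..<N j}) \<union> miss)"
    using finite_early finite_miss by (intro card_mono) auto
  also have "\<dots> \<le> card (new \<union> (early j - {..<N j})) + card miss" by (rule card_Un_le)
  also have "\<dots> \<le> card new + card (early j - {..<N j}) + card miss"
    using card_Un_le[of new "early j - {..<N j}"] by simp
  \<comment> \<open>Misses count twice, for the work ahead they permit and for absences from
    \<open>B\<close> itself. With \<open>j * W \<le> K / 4\<close> and fewer than
    \<open>K / 8\<close> misses, half of \<open>K\<close> is left.\<close>
  finally have "K \<le> card new + j * W + 2 * card miss" using ahead B(2) by linarith
  moreover have "j * W \<le> J * W" using j by simp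
  moreover have "8 * card miss < K" using few by (simp add: miss_def N_def)
  ultimately have "K \<le> 2 * card new" using slack by linarith
  then show ?thesis by (simp add: new_def)
qed

text \<open>Multiplicities are proportional to prices, so the number of packets served bounds the
  price of the colors visited from below.\<close>

lemma card_colored:
  assumes "j < J" "T \<subseteq> set vs"
  shows "card {i \<in> {Suc L + 2 * K * j + K..<Suc L + 2 * K * Suc j}. color (calm ! i) \<in> T} =
    n * (\<Sum>v\<in>T. q v)"
proof -
  let ?b = "Suc L + 2 * K * j + K"
  have color: "color (calm ! (?b + k)) = vlist ! k" if "k < K" for k
    using nth_batch[OF assms(1), of "K + k"] that
    by (simp add: batch_def nth_append length_vlist add.assoc del: map_append)
  have "{i \<in> {?b..<Suc L + 2 * K * Suc j}. color (calm ! i) \<in> T} =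
      (+) ?b ` {k. k < K \<and> vlist ! k \<in> T}" (is "?A = ?B")
  proof (intro equalityI subsetI)
    fix i assume i: "i \<in> ?A"
    then obtain k where k: "i = ?b + k" by (auto dest: le_Suc_ex)
    then have "k < K" using i by simp
    then show "i \<in> ?B" using i k color[of k] by auto
  qed (use color in auto)
  then have "card ?A = card ?B" by (rule arg_cong)
  also have "card ?B = card {k. k < K \<and> vlist ! k \<in> T}"
    by (rule card_image) simp
  also have "\<dots> = length (filter (\<lambda>v. v \<in> T) vlist)"
    by (simp add: length_filter_conv_card length_vlist)
  also have "\<dots> = (\<Sum>v\<leftarrow>vs. if v \<in> T then n * q v else 0)"
    unfolding vlist_def by (induction vs) (simp_all add: filter_replicate)
  also have "\<dots> = (\<Sum>v\<in>set vs. if v \<in> T then n * q v else 0)"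
    by (rule sum_list_distinct_conv_sum_set[OF vs(1)])
  also have "\<dots> = (\<Sum>v\<in>T. n * q v)"
    using assms(2) by (simp add: sum.If_cases Int_absorb1)
  finally show ?thesis by (simp add: sum_distrib_left)
qed

text \<open>Root transmissions in the even periods \<open>2 * i\<close> and \<open>2 * i + 2\<close>
  enclose the odd period between them. There half of the colored packets are served, so the enclosed
  walk is a rooted tour through colors of price at least \<open>Q / 2\<close>. The choice
  \<open>J = 2 * I + 1\<close> provides \<open>I\<close> such frames.\<close>

lemma idle_slots:
  fixes a :: real
  assumes S: "feasible w calm S" and slack: "4 * (J * W) \<le> K"
    and few: "8 * card {i. i < Suc L + 2 * K * J \<and> (\<forall>t. S t \<noteq> Transmit i)} < K"
    and J: "J = 2 * I + 1" and "0 \<le> a"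
    and expensive: "\<And>ys. set ys \<subseteq> insert r (set vs) \<Longrightarrow>
      a * real (\<Sum>v\<in>set ys - {r}. q v) \<le> real (rooted_tour d r ys)"
  shows "real I * (a * real Q) \<le> 2 * real (card {t. 1 \<le> t \<and> t \<le> tt J \<and> (\<forall>i. S t \<noteq> Transmit i)})"
proof -
  note served = batch_served[OF S slack few]
  \<comment> \<open>Applied to the root half of the batch, \<open>served\<close> gives a root
    transmission in every period, to be used as an endpoint of tours.\<close>
  have "\<exists>t i. tt j < t \<and> t \<le> tt (Suc j) \<and> S t = Transmit i \<and> color (calm ! i) = r" if "j < J" for j
  proof -
    let ?B = "{Suc L + 2 * K * j..<Suc L + 2 * K * j + K}"
    have "K \<le> 2 * card {i \<in> ?B. \<exists>t. tt j < t \<and> t \<le> tt (Suc j) \<and> S t = Transmit i}"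
      using that by (intro served) auto
    then have "{i \<in> ?B. \<exists>t. tt j < t \<and> t \<le> tt (Suc j) \<and> S t = Transmit i} \<noteq> {}"
      using K_pos by (metis card.empty mult_0_right not_le)
    then obtain i t where i: "i \<in> ?B" and t: "tt j < t" "t \<le> tt (Suc j)" "S t = Transmit i"
      by blast
    obtain k where "i = Suc L + 2 * K * j + k" "k < K" using i by (auto dest: le_Suc_ex)
    then have "color (calm ! i) = r"
      using nth_batch[OF that, of k] by (simp add: batch_def nth_append del: map_append)
    then show ?thesis using t by blast
  qed
  then obtain \<rho> \<iota> where \<rho>: "\<And>j. j < J \<Longrightarrow> tt j < \<rho> j \<and> \<rho> j \<le> tt (Suc j) \<and>
      S (\<rho> j) = Transmit (\<iota> j) \<and> color (calm ! \<iota> j) = r" by metis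
  have tour: "a * real Q \<le> 2 * real (card {u. \<rho> (2 * i) < u \<and> u < \<rho> (2 * i + 2) \<and> S u = Transition})"
    if "i < I" for i
  proof -
    define j where "j = Suc (2 * i)"
    have j: "j < J" "2 * i < J" "2 * i + 2 < J" using that J by (auto simp: j_def)
    have before: "\<rho> (2 * i) \<le> tt j" and after: "tt (Suc j) < \<rho> (2 * i + 2)"
      using \<rho>[of "2 * i"] \<rho>[of "2 * i + 2"] j by (auto simp: j_def)
    let ?B = "{Suc L + 2 * K * j + K..<Suc L + 2 * K * Suc j}"
    define new where "new = {i \<in> ?B. \<exists>t. tt j < t \<and> t \<le> tt (Suc j) \<and> S t = Transmit i}"
    define T where "T = (\<lambda>i. color (calm ! i)) ` new"
    have T_vs: "T \<subseteq> set vs"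
    proof
      fix v assume "v \<in> T"
      then obtain l where "l \<in> ?B" "v = color (calm ! l)" by (auto simp: T_def new_def)
      moreover from this obtain k where "l = Suc L + 2 * K * j + (K + k)" "k < K"
        by (auto dest!: le_Suc_ex simp: add_ac)
      ultimately have "v = vlist ! k" "k < length vlist"
        using nth_batch[OF j(1), of "K + k"]
        by (simp_all add: batch_def nth_append length_vlist del: map_append)
      then show "v \<in> set vs" using set_vlist nth_mem by blast
    qed
    have "K \<le> 2 * card new"
      unfolding new_def using j(1) by (intro served) auto
    also have "card new \<le> card {i \<in> ?B. color (calm ! i) \<in> T}"
      by (intro card_mono) (auto simp: T_def new_def)
    also have "\<dots> = n * (\<Sum>v\<in>T. q v)" by (rule card_colored[OF j(1) T_vs])
    finally have "n * Q \<le> n * (2 * (\<Sum>v\<in>T. q v))" by (simp add: K_def)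
    then have Q_le: "Q \<le> 2 * (\<Sum>v\<in>T. q v)" using n by simp
    have diag: "w (color (calm ! l)) (color (calm ! l)) \<le> 0" if "l < length calm" for l
      using color_calm[of "calm ! l"] that r vs_less costs by (auto simp: transition_costs_def)
    have "tt j \<le> tt (Suc j)" by (simp add: tt_def)
    then have "\<rho> (2 * i) < \<rho> (2 * i + 2)" using before after by linarith
    then obtain cs where cs: "hd cs = r" "last cs = r" "2 \<le> length cs"
      "set cs = {color (calm ! k) | k u. \<rho> (2 * i) \<le> u \<and> u \<le> \<rho> (2 * i + 2) \<and> S u = Transmit k}"
      "walk_weight d cs \<le> card {u. \<rho> (2 * i) < u \<and> u < \<rho> (2 * i + 2) \<and> S u = Transition}"
      using feasible_walk[OF S diag, of "\<rho> (2 * i)" "\<iota> (2 * i)" "\<rho> (2 * i + 2)" "\<iota> (2 * i + 2)"]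
        \<rho>[OF j(2)] \<rho>[OF j(3)] unfolding d_def[abs_def] by (auto simp: less_imp_le)
    obtain ys where ys: "cs = r # ys @ [r]"
    proof -
      obtain zs where zs: "cs = r # zs" using cs(1,3) by (cases cs) auto
      then have "zs \<noteq> []" using cs(3) by auto
      then have "last zs = r" using cs(2) zs by simp
      then have "butlast zs @ [r] = zs"
        using append_butlast_last_id[OF \<open>zs \<noteq> []\<close>] by (simp only:)
      then show thesis by (intro that[of "butlast zs"]) (simp add: zs)
    qed
    have "set cs \<subseteq> insert r (set vs)"
    proof -
      have "k < length calm" if "S u = Transmit k" for u k
        using S that unfolding feasible_def by blast
      then show ?thesis using color_calm[OF nth_mem] unfolding cs(4) by auto
    qed
    moreover have "T \<subseteq> set cs"
    proof
      fix v assume "v \<in> T"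
      then obtain l t where "v = color (calm ! l)" "tt j < t" "t \<le> tt (Suc j)" "S t = Transmit l"
        by (auto simp: T_def new_def)
      moreover from this have "\<rho> (2 * i) \<le> t" "t \<le> \<rho> (2 * i + 2)"
        using before after by linarith+
      ultimately show "v \<in> set cs" unfolding cs(4) by blast
    qed
    ultimately have "T \<subseteq> set ys - {r}" "set ys \<subseteq> insert r (set vs)"
      using T_vs vs_ne_r by (auto simp: ys)
    have "a * real Q \<le> a * real (2 * (\<Sum>v\<in>T. q v))"
      using Q_le \<open>0 \<le> a\<close> by (intro mult_left_mono of_nat_mono)
    also have "\<dots> \<le> a * real (2 * (\<Sum>v\<in>set ys - {r}. q v))"
      using \<open>T \<subseteq> set ys - {r}\<close> \<open>0 \<le> a\<close>
      by (intro mult_left_mono of_nat_mono mult_le_mono2 sum_mono2) auto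
    also have "\<dots> = 2 * (a * real (\<Sum>v\<in>set ys - {r}. q v))" by simp
    also have "\<dots> \<le> 2 * real (rooted_tour d r ys)"
      using expensive[OF \<open>set ys \<subseteq> insert r (set vs)\<close>] by linarith
    also have "\<dots> \<le> 2 * real (card {u. \<rho> (2 * i) < u \<and> u < \<rho> (2 * i + 2) \<and> S u = Transition})"
      using cs(5) by (simp add: rooted_tour_def ys)
    finally show ?thesis .
  qed
  \<comment> \<open>Successive frames share only their endpoints, which are transmissions, so the
    transition slots of different frames add up.\<close>
  define idle where "idle b = {t. 1 \<le> t \<and> t \<le> b \<and> (\<forall>i. S t \<noteq> Transmit i)}" for b
  have finite_idle: "finite (idle b)" for b by (simp add: idle_def)
  have "real i * (a * real Q) \<le> 2 * real (card (idle (\<rho> (2 * i))))" if "i \<le> I" for i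
    using that
  proof (induction i)
    case (Suc i)
    let ?mid = "{u. \<rho> (2 * i) < u \<and> u < \<rho> (2 * i + 2) \<and> S u = Transition}"
    have "2 * i < J" "2 * i + 2 < J" using Suc.prems J by auto
    then have "\<rho> (2 * i) \<le> tt (Suc (2 * i))" "tt (2 * i + 2) < \<rho> (2 * i + 2)"
      using \<rho> by auto
    moreover have "tt (Suc (2 * i)) \<le> tt (2 * i + 2)" by (simp add: tt_def)
    ultimately have less: "\<rho> (2 * i) < \<rho> (2 * i + 2)" by linarith
    have "card (idle (\<rho> (2 * i)) \<union> ?mid) = card (idle (\<rho> (2 * i))) + card ?mid"
      using finite_idle by (intro card_Un_disjoint) (auto simp: idle_def)
    moreover have "card (idle (\<rho> (2 * i)) \<union> ?mid) \<le> card (idle (\<rho> (2 * i + 2)))"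
      using finite_idle less by (intro card_mono) (auto simp: idle_def)
    ultimately have "real (card (idle (\<rho> (2 * i)))) + real (card ?mid) \<le> real (card (idle (\<rho> (2 * Suc i))))"
      by (simp flip: of_nat_add)
    moreover have "a * real Q \<le> 2 * real (card ?mid)" using Suc.prems by (intro tour) simp
    moreover have "real i * (a * real Q) \<le> 2 * real (card (idle (\<rho> (2 * i))))" using Suc by simp
    moreover have "real (Suc i) * (a * real Q) = real i * (a * real Q) + a * real Q"
      by (simp add: algebra_simps)
    ultimately show ?case by linarith
  qed simp
  from this[of I] have "real I * (a * real Q) \<le> 2 * real (card (idle (\<rho> (2 * I))))" by simp
  also have "\<dots> \<le> 2 * real (card (idle (tt J)))"
  proof -
    have "\<rho> (2 * I) \<le> tt J" using \<rho>[of "2 * I"] J by simp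
    then have "card (idle (\<rho> (2 * I))) \<le> card (idle (tt J))"
      using finite_idle by (intro card_mono) (auto simp: idle_def)
    then show ?thesis by simp
  qed
  finally show ?thesis by (simp add: idle_def)
qed

section \<open>The two inputs against an online algorithm\<close>

lemma calm_valid:
  "valid_input C calm" "calm \<noteq> []" "min_laxity calm = L"
  and flood_valid:
  "valid_input C (calm @ flood)" "calm @ flood \<noteq> []" "min_laxity (calm @ flood) = L"
proof -
  have lax: "Suc L \<le> tt j" "Suc L \<le> E" for j by (simp_all add: tt_def E_eq)
  have calm_pkt: "release p = 1 \<and> 1 + L \<le> deadline p \<and> color p < C" if "p \<in> set calm" for p
    using that lax r vs_less set_vlist
    by (auto simp: calm_def bulk_def filler_def batch_def)
  have flood_pkt: "p = Packet (Suc (tt J)) E r" if "p \<in> set flood" for p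
    using that by (auto simp: flood_def)
  have EJ: "Suc (tt J) + L \<le> E" by (simp add: E_def)
  have calm_releases: "map release calm = replicate (length calm) 1"
    using calm_pkt by (intro replicate_eqI) auto
  have flood_releases: "map release flood = replicate (length flood) (Suc (tt J))"
    by (simp add: flood_def map_replicate_const)
  have sorted_replicate: "sorted (replicate m x)" for m and x :: nat by (induction m) auto
  have bulk_in: "Packet 1 (tt 0) r \<in> set calm" by (simp add: calm_def bulk_def)
  show "calm \<noteq> []" "calm @ flood \<noteq> []" using bulk_in by auto
  show "valid_input C calm"
    using calm_pkt L by (force simp: valid_input_def calm_releases sorted_replicate)
  show "valid_input C (calm @ flood)"
    unfolding valid_input_def
  proof
    show "sorted (map release (calm @ flood))"
      by (auto simp: calm_releases flood_releases sorted_append sorted_replicate)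
    show "\<forall>p\<in>set (calm @ flood). 1 \<le> release p \<and> release p < deadline p \<and> color p < C"
    proof
      fix p assume "p \<in> set (calm @ flood)"
      then consider "p \<in> set calm" | "p \<in> set flood" by auto
      then show "1 \<le> release p \<and> release p < deadline p \<and> color p < C"
      proof cases
        case 1
        then show ?thesis using calm_pkt[OF 1] L by auto
      next
        case 2
        then show ?thesis using flood_pkt[OF 2] EJ L r by auto
      qed
    qed
  qed
  have lax_bulk: "deadline (Packet 1 (tt 0) r) - release (Packet 1 (tt 0) r) = L"
    by (simp add: tt_def)
  have calm_lax: "L \<le> deadline p - release p" if "p \<in> set calm" for p
    using calm_pkt[OF that] by linarith
  have flood_lax: "L \<le> deadline p - release p" if "p \<in> set flood" for p
    using flood_pkt[OF that] EJ by simp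
  show "min_laxity calm = L"
    unfolding min_laxity_def using calm_lax bulk_in lax_bulk
    by (intro Min_eqI) (auto intro!: image_eqI[of _ _ "Packet 1 (tt 0) r"])
  show "min_laxity (calm @ flood) = L"
    unfolding min_laxity_def using calm_lax flood_lax bulk_in lax_bulk
    by (intro Min_eqI) (auto intro!: image_eqI[of _ _ "Packet 1 (tt 0) r"])
qed

lemma ALG_calm_le:
  assumes "online_algorithm C w A"
  shows "ALG A calm + card {i. i < Suc L + 2 * K * J \<and> (\<forall>t. run A calm t \<noteq> Transmit i)} \<le> length calm"
proof -
  let ?served = "{i. \<exists>t. run A calm t = Transmit i}"
  let ?miss = "{i. i < Suc L + 2 * K * J \<and> (\<forall>t. run A calm t \<noteq> Transmit i)}"
  have "feasible w calm (run A calm)"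
    using assms calm_valid(1) by (simp add: online_algorithm_def)
  then have sub: "?served \<subseteq> {..<length calm}" by (auto simp: feasible_def)
  then have "finite ?served" by (rule finite_subset) simp
  then have "card ?served + card ?miss = card (?served \<union> ?miss)"
    by (intro card_Un_disjoint[symmetric]) auto
  also have "\<dots> \<le> card {..<length calm}"
    using sub by (intro card_mono) (auto simp: length_calm)
  finally show ?thesis by (simp add: ALG_def throughput_def)
qed

text \<open>The flood is invisible through slot \<open>tt J\<close>, so the run inherits the empty
  slots of the run on \<open>calm\<close>. As no deadline exceeds \<open>E\<close>, an empty slot is
  lost for good.\<close>

lemma ALG_flood_le:
  assumes "online_algorithm C w A"
  shows "ALG A (calm @ flood) +
    card {t. 1 \<le> t \<and> t \<le> tt J \<and> (\<forall>i. run A calm t \<noteq> Transmit i)} \<le> E"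
proof -
  let ?S = "run A (calm @ flood)"
  let ?idle = "{t. 1 \<le> t \<and> t \<le> tt J \<and> (\<forall>i. run A calm t \<noteq> Transmit i)}"
  let ?busy = "{t. \<exists>i. ?S t = Transmit i}"
  have same: "run A calm t = ?S t" if "t \<le> tt J" for t
  proof -
    have "filter (\<lambda>p. release p \<le> t) flood = []"
      using that by (simp add: flood_def filter_empty_conv)
    then show ?thesis by (simp add: run_def)
  qed
  have feas: "feasible w (calm @ flood) ?S"
    using assms flood_valid(1) by (simp add: online_algorithm_def)
  have deadline_E: "deadline p \<le> E" if "p \<in> set (calm @ flood)" for p
  proof -
    have "tt (Suc j) \<le> E" if "j < J" for j using that by (intro tt_le_E) simp
    then show ?thesis
      using that tt_le_E[of 0] by (auto simp: calm_def bulk_def filler_def flood_def batch_def)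
  qed
  have busy: "t \<in> {1..E}" if t: "?S t = Transmit i" for t i
  proof -
    have i: "i < length (calm @ flood)" "release ((calm @ flood) ! i) \<le> t"
      "t \<le> deadline ((calm @ flood) ! i)"
      using feas t unfolding feasible_def by blast+
    have "(calm @ flood) ! i \<in> set (calm @ flood)" using i(1) by (rule nth_mem)
    then show ?thesis
      using i deadline_E flood_valid(1) unfolding valid_input_def by fastforce
  qed
  then have fin: "finite ?busy" by (intro finite_subset[of ?busy "{1..E}"]) auto
  have "{i. \<exists>t. ?S t = Transmit i} \<subseteq> (\<lambda>t. case ?S t of Transmit i \<Rightarrow> i | _ \<Rightarrow> 0) ` ?busy"
    by (force simp: image_iff)
  then have "ALG A (calm @ flood) \<le> card ?busy"
    unfolding ALG_def throughput_def using fin by (rule surj_card_le[rotated])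
  moreover have "card ?busy + card ?idle = card (?busy \<union> ?idle)"
    using fin same by (intro card_Un_disjoint[symmetric]) auto
  moreover have "card (?busy \<union> ?idle) \<le> card {1..E}"
    using busy tt_le_E[of J] by (intro card_mono) auto
  ultimately show ?thesis by simp
qed

text \<open>The input is chosen by whether the run on \<open>calm\<close> misses fewer than
  \<open>K / 8\<close> packets of bulk and batches. Since \<open>length calm \<le> E\<close>, one
  \<open>\<delta>\<close> measured against \<open>E\<close> covers both cases.\<close>

lemma adversary:
  fixes \<delta> a :: real
  assumes A: "online_algorithm C w A" and slack: "4 * (J * W) \<le> K" and J: "J = 2 * I + 1" and "0 \<le> a"
    and expensive: "\<And>ys. set ys \<subseteq> insert r (set vs) \<Longrightarrow>
      a * real (\<Sum>v\<in>set ys - {r}. q v) \<le> real (rooted_tour d r ys)"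
    and \<delta>: "0 \<le> \<delta>" "\<delta> \<le> 1" "8 * (\<delta> * real E) \<le> real K" "2 * (\<delta> * real E) \<le> real I * (a * real Q)"
  shows "\<exists>\<sigma>. valid_input C \<sigma> \<and> \<sigma> \<noteq> [] \<and> min_laxity \<sigma> = L \<and>
    real (ALG A \<sigma>) \<le> (1 - \<delta>) * real (OPT w \<sigma>)"
proof (cases "8 * card {i. i < Suc L + 2 * K * J \<and> (\<forall>t. run A calm t \<noteq> Transmit i)} < K")
  case True
  have "feasible w calm (run A calm)"
    using A calm_valid(1) by (simp add: online_algorithm_def)
  from idle_slots[OF this slack True J \<open>0 \<le> a\<close> expensive]
  have "\<delta> * real E \<le> real (card {t. 1 \<le> t \<and> t \<le> tt J \<and> (\<forall>i. run A calm t \<noteq> Transmit i)})"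
    using \<delta>(4) by simp
  then have "real (ALG A (calm @ flood)) \<le> real E - \<delta> * real E"
    using ALG_flood_le[OF A] by linarith
  also have "\<dots> = (1 - \<delta>) * real E" by (simp add: algebra_simps)
  also have "\<dots> \<le> (1 - \<delta>) * real (OPT w (calm @ flood))"
    using OPT_flood \<delta>(2) by (intro mult_left_mono) auto
  finally show ?thesis using flood_valid by blast
next
  case False
  have "8 * (\<delta> * real (length calm)) \<le> 8 * (\<delta> * real E)"
    using \<delta>(1) length_calm_le_E by (intro mult_left_mono) auto
  then have "real (ALG A calm) \<le> real (length calm) - \<delta> * real (length calm)"
    using ALG_calm_le[OF A] False \<delta>(3) by linarith
  also have "\<dots> = (1 - \<delta>) * real (length calm)" by (simp add: algebra_simps)
  also have "\<dots> \<le> (1 - \<delta>) * real (OPT w calm)"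
    using OPT_calm \<delta>(2) by (intro mult_left_mono) auto
  finally show ?thesis using calm_valid by blast
qed

end

section \<open>Choice of the parameters\<close>

text \<open>With about \<open>K / x\<close> periods, \<open>E\<close> is of order
  \<open>L + K^2 / x\<close> while the loss is of order \<open>K\<close>. Balancing the two terms
  gives \<open>K\<close> near \<open>sqrt (x * L)\<close> and relative loss near
  \<open>sqrt (x / L)\<close>. If \<open>x\<close> is large against \<open>L\<close>, then
  \<open>K\<close> of order \<open>x\<close> already gives a constant relative loss.\<close>

lemma period_parameters:
  fixes x f :: real and L P W :: nat
  assumes P: "1 \<le> P" "real P \<le> x" and W: "real W \<le> 2 * x" and L: "1 \<le> L"
    and f: "0 \<le> f" "f \<le> 4" "f \<le> 4 * sqrt (x / real L)"
  obtains n I where "1 \<le> n" "4 * ((2 * I + 1) * W) \<le> n * P"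
    "f * (2 * real L + 2 + real (2 * I + 1) * (3 * real (n * P) + 2 * real W)) \<le> 576 * real (n * P)"
    "real (n * P) \<le> 48 * (real I * x)"
proof -
  have x1: "1 \<le> x" using P by linarith
  \<comment> \<open>The bound \<open>24 * x\<close> ensures that at least one frame fits,
    \<open>1 \<le> I\<close>.\<close>
  define y where "y = max (24 * x) (sqrt (x * real L))"
  have y: "24 * x \<le> y" "sqrt (x * real L) \<le> y" by (auto simp: y_def)
  define n where "n = nat \<lceil>y / real P\<rceil>"
  have pos: "0 < y / real P" using y x1 P by simp
  then have n1: "1 \<le> n" unfolding n_def by linarith
  have n_bounds: "y / real P \<le> real n" "real n < y / real P + 1"
    using pos unfolding n_def by linarith+
  define K where "K = n * P"
  have Ky: "y \<le> real K"
    using n_bounds(1) P by (simp add: K_def pos_divide_le_eq)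
  have "real K \<le> y + real P"
  proof -
    have "real n * real P \<le> (y / real P + 1) * real P"
      using n_bounds(2) by (intro mult_right_mono) auto
    then show ?thesis using P by (simp add: K_def distrib_right)
  qed
  then have K2: "real K \<le> 2 * y" using P x1 y by linarith
  have K24: "24 * x \<le> real K" using y Ky by linarith
  \<comment> \<open>The divisor comes from \<open>J \<le> 3 * I\<close> and
    \<open>W \<le> 2 * x\<close>, which turn \<open>4 * J * W\<close> into at most
    \<open>24 * I * x\<close>.\<close>
  define I where "I = nat \<lfloor>real K / (24 * x)\<rfloor>"
  have "1 \<le> real K / (24 * x)" using K24 x1 by simp
  then have I: "1 \<le> I" "real I \<le> real K / (24 * x)" "real K / (24 * x) < real I + 1"
    unfolding I_def by linarith+
  have I_up: "24 * (real I * x) \<le> real K" using I(2) x1 by (simp add: field_simps)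
  have I_low: "real K \<le> 48 * (real I * x)"
  proof -
    have "real K / (24 * x) \<le> 2 * real I" using I by linarith
    then show ?thesis using x1 by (simp add: field_simps)
  qed
  define J where "J = 2 * I + 1"
  have JI: "real J \<le> 3 * real I" using I(1) by (simp add: J_def)
  have JW: "4 * (real J * real W) \<le> real K"
  proof -
    have "real J * real W \<le> (3 * real I) * (2 * x)"
      using JI W by (intro mult_mono) auto
    then show ?thesis using I_up by linarith
  qed
  define E where "E = 2 * real L + 2 + real J * (3 * real K + 2 * real W)"
  \<comment> \<open>The term \<open>3 * J * K\<close> contributes at most
    \<open>3/8 * K^2 / x\<close>, and \<open>2 * J * W\<close> at most \<open>K / 2\<close>, that is
    at most \<open>K^2 / (48 * x)\<close>.\<close>
  have E_le: "E \<le> 4 * real L + (real K)\<^sup>2 / (2 * x)"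
  proof -
    have "real J * real K \<le> 3 * (real K / (24 * x)) * real K"
      using JI I(2) by (intro mult_right_mono) auto
    also have "\<dots> = 1 / 8 * ((real K)\<^sup>2 / x)" using x1 by (simp add: power2_eq_square)
    finally have JK: "real J * real K \<le> 1 / 8 * ((real K)\<^sup>2 / x)" .
    have "24 * real K \<le> (real K)\<^sup>2 / x"
      using mult_right_mono[OF K24, of "real K"] x1
      by (simp add: pos_le_divide_eq power2_eq_square mult_ac)
    then show ?thesis using JK JW L by (simp add: E_def algebra_simps)
  qed
  have E0: "0 \<le> E" by (simp add: E_def)
  \<comment> \<open>The threshold \<open>L = 576 * x\<close> is where \<open>24 * x\<close> and
    \<open>sqrt (x * L)\<close> coincide. The factor 576 is dictated by the case of large
    \<open>x\<close>, as \<open>4 * 3456 = 576 * 24\<close>.\<close>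
  have "f * E \<le> 576 * real K"
  proof (cases "576 * x \<le> real L")
    case True
    have "24 * x \<le> sqrt (x * real L)"
    proof (rule real_le_rsqrt)
      have "x * (576 * x) \<le> x * real L" using True x1 by (intro mult_left_mono) auto
      then show "(24 * x)\<^sup>2 \<le> x * real L" by (simp add: power2_eq_square)
    qed
    then have y_eq: "y = sqrt (x * real L)" by (simp add: y_def)
    have "(real K)\<^sup>2 \<le> (2 * y)\<^sup>2" using K2 by (intro power_mono) auto
    then have "(real K)\<^sup>2 \<le> 4 * (x * real L)" using x1 by (simp add: y_eq power_mult_distrib)
    then have "(real K)\<^sup>2 / (2 * x) \<le> 2 * real L" using x1 by (simp add: field_simps)
    then have "E \<le> 6 * real L" using E_le by linarith
    then have "f * E \<le> (4 * sqrt (x / real L)) * (6 * real L)"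
      using f E0 x1 by (intro mult_mono) auto
    also have "\<dots> = 24 * sqrt (x / real L * (real L)\<^sup>2)"
      by (simp only: real_sqrt_mult real_sqrt_abs abs_of_nat)
    also have "x / real L * (real L)\<^sup>2 = x * real L"
      using L by (simp add: power2_eq_square)
    also have "24 * sqrt (x * real L) \<le> 576 * real K" using y Ky by simp
    finally show ?thesis .
  next
    case False
    have "sqrt (x * real L) \<le> 24 * x"
    proof (rule real_le_lsqrt)
      have "x * real L \<le> x * (576 * x)" using False x1 by (intro mult_left_mono) auto
      then show "x * real L \<le> (24 * x)\<^sup>2" by (simp add: power2_eq_square)
    qed (use x1 in auto)
    then have "real K \<le> 48 * x" using K2 by (simp add: y_def)
    then have "(real K)\<^sup>2 \<le> (48 * x)\<^sup>2" by (intro power_mono) auto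
    then have "(real K)\<^sup>2 / (2 * x) \<le> 1152 * x"
      using x1 by (simp add: pos_divide_le_eq power2_eq_square)
    then have "E \<le> 3456 * x" using E_le False by linarith
    then have "f * E \<le> 4 * (3456 * x)" using f E0 x1 by (intro mult_mono) auto
    then show ?thesis using K24 by linarith
  qed
  moreover have "4 * (J * W) \<le> K"
  proof -
    have "real (4 * (J * W)) \<le> real K" using JW by simp
    then show ?thesis by (simp only: of_nat_le_iff)
  qed
  ultimately show thesis
    using that[of n I] n1 I_low by (simp add: E_def J_def K_def)
qed

lemma adversary_from_expensive_colors:
  fixes a :: real
  assumes costs: "transition_costs C w" and L: "1 \<le> L"
    and r: "r < C" and vs: "distinct vs" "vs \<noteq> []" "set vs \<subseteq> {..<C} - {r}"
    and q: "\<And>v. v \<in> set vs \<Longrightarrow> 1 \<le> q v" and a: "1 \<le> a"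
    and cheap: "real (rooted_tour (\<lambda>j k. nat \<lceil>w j k\<rceil>) r vs) \<le> 2 * (a * real (\<Sum>v\<in>set vs. q v))"
    and expensive: "\<And>ys. set ys \<subseteq> insert r (set vs) \<Longrightarrow>
      a * real (\<Sum>v\<in>set ys - {r}. q v) \<le> real (rooted_tour (\<lambda>j k. nat \<lceil>w j k\<rceil>) r ys)"
    and A: "online_algorithm C w A"
    and f: "0 \<le> f" "f \<le> 4" "f \<le> 4 * sqrt (a * real (\<Sum>v\<in>set vs. q v) / real L)"
  shows "\<exists>\<sigma>. valid_input C \<sigma> \<and> \<sigma> \<noteq> [] \<and> min_laxity \<sigma> = L \<and>
    real (ALG A \<sigma>) \<le> (1 - 1 / 55296 * f) * real (OPT w \<sigma>)"
proof -
  have "set vs \<noteq> {}" using vs(2) by simp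
  then have "0 < (\<Sum>v\<in>set vs. q v)" using q by (intro sum_pos) (auto simp: Suc_le_eq)
  then have pos: "1 \<le> (\<Sum>v\<in>set vs. q v)" by linarith
  have "1 * real (\<Sum>v\<in>set vs. q v) \<le> a * real (\<Sum>v\<in>set vs. q v)"
    using a by (rule mult_right_mono) (rule of_nat_0_le_iff)
  then have le: "real (\<Sum>v\<in>set vs. q v) \<le> a * real (\<Sum>v\<in>set vs. q v)" unfolding mult_1 .
  obtain n I where n: "1 \<le> n" and param:
    "4 * ((2 * I + 1) * rooted_tour (\<lambda>j k. nat \<lceil>w j k\<rceil>) r vs) \<le> n * (\<Sum>v\<in>set vs. q v)"
    "f * (2 * real L + 2 + real (2 * I + 1) * (3 * real (n * (\<Sum>v\<in>set vs. q v)) +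
      2 * real (rooted_tour (\<lambda>j k. nat \<lceil>w j k\<rceil>) r vs))) \<le> 576 * real (n * (\<Sum>v\<in>set vs. q v))"
    "real (n * (\<Sum>v\<in>set vs. q v)) \<le> 48 * (real I * (a * real (\<Sum>v\<in>set vs. q v)))"
    by (rule period_parameters[OF pos le cheap L f])
  interpret hard_input w C r L n "2 * I + 1" vs q
    by unfold_locales (use costs L n r vs q in auto)
  have d_eq: "d = (\<lambda>j k. nat \<lceil>w j k\<rceil>)" by (rule ext)+ (rule d_def)
  have E: "f * real E \<le> 576 * real K"
    using param(2) unfolding real_E K_def Q_def W_def d_eq .
  have I: "real K \<le> 48 * (real I * (a * real Q))" using param(3) by (simp add: K_def Q_def)
  show ?thesis
  proof (rule adversary[OF A _ refl, where a = a])
    show "4 * ((2 * I + 1) * W) \<le> K" using param(1) by (simp only: K_def Q_def W_def d_eq)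
    show "a * real (\<Sum>v\<in>set ys - {r}. q v) \<le> real (rooted_tour d r ys)"
      if "set ys \<subseteq> insert r (set vs)" for ys
      using expensive[OF that] by (simp only: d_eq)
    \<comment> \<open>Here \<open>55296 = 2 * 576 * 48\<close> is what the bound on idle slots
      needs; the bound on misses holds with room to spare.\<close>
    show "8 * (1 / 55296 * f * real E) \<le> real K" using E by simp
    show "2 * (1 / 55296 * f * real E) \<le> real I * (a * real Q)" using E I by simp
  qed (use a f in auto)
qed

text \<open>Handles tours of weight 0, where no loss is required but some nonempty input of minimal
  laxity \<open>L\<close> must still be exhibited.\<close>

lemma trivial_input:
  assumes "1 \<le> L" "0 < C" "online_algorithm C w A"
  shows "\<exists>\<sigma>. valid_input C \<sigma> \<and> \<sigma> \<noteq> [] \<and> min_laxity \<sigma> = L \<and> real (ALG A \<sigma>) \<le> real (OPT w \<sigma>)"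
proof (intro exI[of _ "[Packet 1 (Suc L) 0]"] conjI)
  show valid: "valid_input C [Packet 1 (Suc L) 0]" using assms by (simp add: valid_input_def)
  then have "feasible w [Packet 1 (Suc L) 0] (run A [Packet 1 (Suc L) 0])"
    using assms(3) by (simp add: online_algorithm_def)
  then show "real (ALG A [Packet 1 (Suc L) 0]) \<le> real (OPT w [Packet 1 (Suc L) 0])"
    unfolding ALG_def by (simp add: throughput_le_OPT)
qed (simp_all add: min_laxity_def)

section \<open>Tour weight, logarithm and conclusion\<close>

lemma TSP_bounds:
  assumes "transition_costs C w"
  shows "0 \<le> TSP C w"
    and "set xs = {..<C} \<Longrightarrow> TSP C w \<le> tour_weight w xs"
proof -
  have nonneg: "0 \<le> tour_weight w xs" if xs: "set xs = {..<C}" for xs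
    unfolding tour_weight_def
  proof (rule sum_nonneg)
    fix i assume "i \<in> {..<length xs}"
    then have "i < length xs" by simp
    moreover from this have "Suc i mod length xs < length xs" by (intro mod_less_divisor) linarith
    ultimately have "xs ! i < C" "xs ! (Suc i mod length xs) < C" using xs nth_mem by blast+
    then show "0 \<le> w (xs ! i) (xs ! (Suc i mod length xs))"
      using assms by (simp add: transition_costs_def)
  qed
  have "set [0..<C] = {..<C}" by auto
  then show "0 \<le> TSP C w" unfolding TSP_def using nonneg by (intro cInf_greatest) blast+
  have "bdd_below {tour_weight w xs | xs. set xs = {..<C}}"
    using nonneg by (intro bdd_belowI[of _ 0]) auto
  then show "TSP C w \<le> tour_weight w xs" if "set xs = {..<C}"
    unfolding TSP_def using that by (intro cInf_lower) auto
qed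

text \<open>A closed walk repeats its first vertex, whereas \<open>tour_weight\<close> closes the
  tour by itself, so the last entry is dropped. A walk of one entry is kept, as its closing step is
  free.\<close>

lemma TSP_le_closed_walk:
  assumes costs: "transition_costs C w" and ws: "ws \<noteq> []" "hd ws = last ws" "set ws = {..<C}"
  shows "TSP C w \<le> real (walk_weight (\<lambda>j k. nat \<lceil>w j k\<rceil>) ws)"
proof -
  let ?d = "\<lambda>j k. nat \<lceil>w j k\<rceil>"
  obtain xs where xs: "xs \<noteq> []" "set xs = {..<C}"
    "walk_weight ?d (xs @ [hd xs]) \<le> walk_weight ?d ws"
  proof -
    obtain us c where us: "ws = us @ [c]" using ws(1) rev_exhaust by blast
    show thesis
    proof (cases "us = []")
      case True
      then have "c < C" using ws(3) us by auto
      then have "w c c = 0" using costs by (simp add: transition_costs_def)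
      then show ?thesis using that[of ws] ws(1,3) us True by simp
    next
      case False
      then have c: "c = hd us" using ws(2) us by simp
      then have "set ws = set us" using us hd_in_set[OF False] by auto
      then have "set us = {..<C}" using ws(3) by simp
      moreover have "walk_weight ?d (us @ [hd us]) \<le> walk_weight ?d ws" using us c by simp
      ultimately show ?thesis using that[OF False] by blast
    qed
  qed
  have "TSP C w \<le> tour_weight w xs" by (rule TSP_bounds(2)[OF costs xs(2)])
  also have "\<dots> \<le> (\<Sum>i<length xs. real (?d (xs ! i) (xs ! (Suc i mod length xs))))"
    unfolding tour_weight_def by (intro sum_mono) linarith
  also have "\<dots> = real (walk_weight ?d (xs @ [hd xs]))"
    by (simp add: closed_walk_weight_conv_sum[OF xs(1)])
  finally show ?thesis using xs(3) by linarith
qed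

lemma ln_2_ge_half: "1 / 2 \<le> ln (2 :: real)"
proof -
  have "ln (1 / 2) \<le> (1 / 2 :: real) - 1" by (rule ln_le_minus_one) simp
  then show ?thesis by (simp add: ln_div)
qed

text \<open>Rounding \<open>log 2 C\<close> up at most doubles it, since it is at least 1; the other
  factor 2 bounds \<open>1 / ln 2\<close>.\<close>

lemma log_bound:
  assumes "2 \<le> C"
  obtains k where "C \<le> 2 ^ k" "real k \<le> 4 * ln (real C)"
proof (rule that[of "nat \<lceil>log 2 (real C)\<rceil>"])
  let ?k = "nat \<lceil>log 2 (real C)\<rceil>"
  have log1: "1 \<le> log 2 (real C)" using assms by (simp add: le_log_iff)
  have "real C = 2 powr log 2 (real C)" using assms by simp
  also have "\<dots> \<le> 2 powr real ?k" using log1 by (intro powr_mono) linarith+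
  also have "\<dots> = real (2 ^ ?k)" by (simp add: powr_realpow)
  finally show "C \<le> 2 ^ ?k" by (simp only: of_nat_le_iff)
  have "real ?k \<le> 2 * log 2 (real C)" using log1 by linarith
  also have "\<dots> \<le> 4 * ln (real C)"
  proof -
    have "ln (real C) * 1 \<le> ln (real C) * (2 * ln 2)"
      using ln_2_ge_half assms by (intro mult_left_mono) auto
    then show ?thesis using ln_2_ge_half by (simp add: log_def field_simps)
  qed
  finally show "real ?k \<le> 4 * ln (real C)" .
qed

text \<open>The common form of both claims, with \<open>f\<close> standing for
  \<open>sqrt (\<gamma> / ln C)\<close> or for \<open>1 / ln C\<close>.\<close>

lemma adversary_small_loss:
  assumes C: "2 \<le> C" and costs: "transition_costs C w" and L: "1 \<le> L"
    and A: "online_algorithm C w A"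
    and f: "0 \<le> f" "f \<le> 4" "f\<^sup>2 \<le> TSP C w / real L / ln (real C)"
  shows "\<exists>\<sigma>. valid_input C \<sigma> \<and> \<sigma> \<noteq> [] \<and> min_laxity \<sigma> = L \<and>
    real (ALG A \<sigma>) \<le> (1 - 1 / 55296 * f) * real (OPT w \<sigma>)"
proof (cases "TSP C w = 0")
  case True
  then have "f = 0" using f(3) by simp
  then show ?thesis using trivial_input[OF L _ A] C by simp
next
  case False
  then have T: "0 < TSP C w" using TSP_bounds(1)[OF costs] by simp
  have lnC: "0 < ln (real C)" using C by simp
  obtain k where k: "C \<le> 2 ^ k" "real k \<le> 4 * ln (real C)" by (rule log_bound[OF C])
  define d where "d = (\<lambda>i j. nat \<lceil>w i j\<rceil>)"
  have diag: "d j j = 0" if "j < C" for j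
    using costs that by (simp add: d_def transition_costs_def)
  have tri: "d i j \<le> d i l + d l j" if "i < C" "j < C" "l < C" for i j l
  proof -
    have "w i j \<le> w i l + w l j" "0 \<le> w i l" "0 \<le> w l j"
      using costs that by (auto simp: transition_costs_def)
    \<comment> \<open>Rounding up is monotone and subadditive, so the triangle inequality survives
      it.\<close>
    then have "\<lceil>w i j\<rceil> \<le> \<lceil>w i l\<rceil> + \<lceil>w l j\<rceil>" by linarith
    then show ?thesis unfolding d_def by linarith
  qed
  have "0 < C" using C by simp
  obtain r vs q a where exp: "r < C" "distinct vs" "vs \<noteq> []" "set vs \<subseteq> {..<C} - {r}"
    "\<And>v. v \<in> set vs \<Longrightarrow> 1 \<le> q v" "1 \<le> a"
    "TSP C w \<le> 4 * real k * (a * real (\<Sum>v\<in>set vs. q v))"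
    "real (rooted_tour d r vs) \<le> 2 * (a * real (\<Sum>v\<in>set vs. q v))"
    "\<And>ys. set ys \<subseteq> insert r (set vs) \<Longrightarrow>
      a * real (\<Sum>v\<in>set ys - {r}. q v) \<le> real (rooted_tour d r ys)"
  proof (rule expensive_colors[of C d k "TSP C w"])
    show "TSP C w \<le> real (walk_weight d ws)"
      if "ws \<noteq> []" "hd ws = last ws" "set ws = {..<C}" for ws
      unfolding d_def by (rule TSP_le_closed_walk[OF costs that])
  qed (use diag tri k \<open>0 < C\<close> T that in auto)
  define x where "x = a * real (\<Sum>v\<in>set vs. q v)"
  have "0 \<le> x" unfolding x_def using exp(6) by (intro mult_nonneg_nonneg of_nat_0_le_iff) linarith
  then have "real k * (4 * x) \<le> 4 * ln (real C) * (4 * x)" by (intro mult_right_mono k) simp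
  moreover have "TSP C w \<le> 4 * real k * x" using exp(7) by (simp only: x_def)
  \<comment> \<open>The factor 16 combines the 4 of \<open>expensive_colors\<close> with the 4 of
    \<open>log_bound\<close>.\<close>
  ultimately have "TSP C w \<le> 16 * ln (real C) * x" by linarith
  then have "TSP C w / real L / ln (real C) \<le> 16 * (x / real L)"
    using L lnC by (simp add: field_simps)
  then have "f\<^sup>2 \<le> 16 * (x / real L)" using f(3) by linarith
  also have "\<dots> = (4 * sqrt (x / real L))\<^sup>2" using \<open>0 \<le> x\<close> by (simp add: power_mult_distrib)
  finally have "f \<le> 4 * sqrt (x / real L)"
    by (rule power2_le_imp_le) (use \<open>0 \<le> x\<close> in simp)
  then have f_le: "f \<le> 4 * sqrt (a * real (\<Sum>v\<in>set vs. q v) / real L)" by (simp only: x_def)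
  show ?thesis
  proof (rule adversary_from_expensive_colors[OF costs L exp(1-4) _ exp(6) _ _ A f(1,2) f_le])
    show "1 \<le> q v" if "v \<in> set vs" for v by (rule exp(5)[OF that])
    show "real (rooted_tour (\<lambda>j k. nat \<lceil>w j k\<rceil>) r vs) \<le> 2 * (a * real (\<Sum>v\<in>set vs. q v))"
      using exp(8) unfolding d_def .
    show "a * real (\<Sum>v\<in>set ys - {r}. q v) \<le> real (rooted_tour (\<lambda>j k. nat \<lceil>w j k\<rceil>) r ys)"
      if "set ys \<subseteq> insert r (set vs)" for ys
      using exp(9)[OF that] unfolding d_def .
  qed
qed

theorem theorem4:
  "\<exists>c::real. c > 0 \<and>
     (\<forall>(C::nat) (w :: nat \<Rightarrow> nat \<Rightarrow> real) (L::nat) (\<gamma>::real).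
        C \<ge> 2 \<longrightarrow> transition_costs C w \<longrightarrow> L \<ge> 1 \<longrightarrow> \<gamma> = TSP C w / real L \<longrightarrow>
        (\<gamma> < 1 / ln (real C) \<longrightarrow>
           (\<forall>A. online_algorithm C w A \<longrightarrow>
              (\<exists>\<sigma>. valid_input C \<sigma> \<and> \<sigma> \<noteq> [] \<and> min_laxity \<sigma> = L \<and>
                 real (ALG A \<sigma>) \<le> (1 - c * sqrt (\<gamma> / ln (real C))) * real (OPT w \<sigma>)))) \<and>
        (\<gamma> \<ge> 1 / ln (real C) \<longrightarrow>
           (\<forall>A. online_algorithm C w A \<longrightarrow>
              (\<exists>\<sigma>. valid_input C \<sigma> \<and> \<sigma> \<noteq> [] \<and> min_laxity \<sigma> = L \<and>
                 real (ALG A \<sigma>) \<le> (1 - c * (1 / ln (real C))) * real (OPT w \<sigma>)))))"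
proof (intro exI[of _ "1 / 55296"] conjI allI impI)
  fix C L :: nat and w :: "nat \<Rightarrow> nat \<Rightarrow> real" and \<gamma> :: real and A :: algorithm
  assume C: "2 \<le> C" and costs: "transition_costs C w" and L: "1 \<le> L"
    and \<gamma>: "\<gamma> = TSP C w / real L" and A: "online_algorithm C w A"
  have lnC: "0 < ln (real C)" using C by simp
  have inv: "1 / ln (real C) \<le> 4"
  proof -
    note ln_2_ge_half
    also have "ln 2 \<le> ln (real C)" using C by simp
    finally show ?thesis using lnC by (simp add: field_simps)
  qed
  have \<gamma>0: "0 \<le> \<gamma>" using TSP_bounds(1)[OF costs] by (simp add: \<gamma>)
  {
    assume less: "\<gamma> < 1 / ln (real C)"
    have "\<gamma> / ln (real C) \<le> (1 / ln (real C))\<^sup>2"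
      using divide_right_mono[of \<gamma> "1 / ln (real C)" "ln (real C)"] less lnC
      by (simp add: power2_eq_square)
    then have le: "sqrt (\<gamma> / ln (real C)) \<le> 1 / ln (real C)"
      using lnC by (intro real_le_lsqrt) auto
    show "\<exists>\<sigma>. valid_input C \<sigma> \<and> \<sigma> \<noteq> [] \<and> min_laxity \<sigma> = L \<and>
        real (ALG A \<sigma>) \<le> (1 - 1 / 55296 * sqrt (\<gamma> / ln (real C))) * real (OPT w \<sigma>)"
    proof (rule adversary_small_loss[OF C costs L A])
      have "0 \<le> \<gamma> / ln (real C)" using \<gamma>0 lnC by simp
      then show "(sqrt (\<gamma> / ln (real C)))\<^sup>2 \<le> TSP C w / real L / ln (real C)"
        "0 \<le> sqrt (\<gamma> / ln (real C))"
        by (simp_all only: real_sqrt_pow2 real_sqrt_ge_zero \<gamma> order_refl)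
      show "sqrt (\<gamma> / ln (real C)) \<le> 4"
        using le inv by linarith
    qed
  next
    assume ge: "1 / ln (real C) \<le> \<gamma>"
    \<comment> \<open>At \<open>\<gamma> = 1 / ln C\<close> both losses agree; beyond it the loss
      \<open>1 / ln C\<close> is the smaller one and still satisfies the condition on the
      square.\<close>
    then have ge2: "(1 / ln (real C))\<^sup>2 \<le> \<gamma> / ln (real C)"
      using divide_right_mono[OF ge, of "ln (real C)"] lnC by (simp add: power2_eq_square)
    show "\<exists>\<sigma>. valid_input C \<sigma> \<and> \<sigma> \<noteq> [] \<and> min_laxity \<sigma> = L \<and>
        real (ALG A \<sigma>) \<le> (1 - 1 / 55296 * (1 / ln (real C))) * real (OPT w \<sigma>)"
    proof (rule adversary_small_loss[OF C costs L A])
      show "(1 / ln (real C))\<^sup>2 \<le> TSP C w / real L / ln (real C)"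
        using ge2 unfolding \<gamma> .
      show "0 \<le> 1 / ln (real C)" using lnC by simp
    qed (rule inv)
  }
qed simp

end
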